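(* Let $r\ge1$ and $d\ge0$ be integers, let $\lambda:\lambda_1\ge\cdots\ge\lambda_{r+1}$ be a non-increasing sequence of integers, and let $\mu=(\mu_1,\ldots,\mu_{r+1})\in\mathbb{Z}^{r+1}$ be majorized by $\lambda$. For every integer $k\ge d$, the composition $\mathcal{S}^k\circ\Phi_{\lambda,\mu}$ defines a bijection from the set $\mathscr{P}_r(d)$ of $r$-colored partitions of $d$ to the set $\mathbb{P}^k_{\lambda,\mu}(d)$ of POPs with bounding sequence $\tilde\lambda$ (the shift by $k$ of $\lambda$), weight $(\mu_1+k,\ldots,\mu_{r+1}+k)$, and satisfying $$\square^{\mathrm{prop}}(\mathcal{P})+\sum_{1\le i\le j\le r}|\pi(j)^i|=d,$$ where $\mathcal{P}$ is the underlying pattern and the $\pi(j)^i$ are the partitions of the overlay.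
   Context: Partitions. A partition is a non-increasing, eventually zero sequence $\pi_1\ge\pi_2\ge\cdots$ of non-negative integers; $|\pi|$ is the sum of its terms; its parts are its non-zero terms. It fits into the rectangle $(a,b)$ if it has at most $a$ parts and every part is at most $b$. An $r$-colored partition of $d$ is an $r$-tuple $(\pi(1),\ldots,\pi(r))$ of partitions with $|\pi(1)|+\cdots+|\pi(r)|=d$. Majorization. For $x,y\in\mathbb{R}^n$, $x$ majorizes $y$ if, for all $1\le k\le n$, the sum of the $k$ largest coordinates of $x$ is at least that of $y$, with equality for $k=n$. Patterns and POPs. Non-increasing sequences $\lambda$ of length $m$ and $\mu$ of length $m-1$ interlace if $\lambda_i\ge\mu_i\ge\lambda_{i+1}$ for $1\le i\le m-1$. An integral GT pattern is a sequence $\lambda^1,\ldots,\lambda^{r+1}$ of non-increasing integer sequences, $\lambda^j$ of length $j$, with $\lambda^j,\lambda^{j+1}$ interlacing for $1\le j\le r$; its bounding sequence is $\lambda^{r+1}$, and its weight is $(a_1,\ldots,a_{r+1})$ where $a_j$ is the sum of row $j$ minus the sum of row $j-1$ (row $0$ is empty). A partition overlaid pattern (POP) is an integral GT pattern together with partitions $\pi(j)^i$, $1\le i\le j\le r$, such that $\pi(j)^i$ fits into the rectangle $(\lambda^{j+1}_i-\lambda^j_i,\lambda^j_i-\lambda^{j+1}_{i+1})$. The proper trapezoidal area is $$\square^{\mathrm{prop}}(\mathcal{P})=\sum_{j=2}^r\ \sum_{1\le i<h\le j}(\lambda^{j+1}_i-\lambda^j_i)(\lambda^j_h-\lambda^{j+1}_{h+1}).$$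 The map $\Xi_\eta$. Let $s\ge1$ and let $\eta=(\eta_1,\ldots,\eta_{s+1})$ be an integer sequence with $\eta_2\ge\cdots\ge\eta_s$. For an integer $m$ and a partition $\pi$, define $\Xi_\eta(m,\pi)=(\eta',\pi^1,\ldots,\pi^s)$, where $\eta'=(\eta'_1,\ldots,\eta'_s)$ is an integer sequence and the $\pi^j$ are partitions, as follows. If $s=1$: $\eta'_1=\eta_1+\eta_2-m$ and $\pi^1=\pi$. If $s\ge2$: put $c_j=m-\eta_{j+1}$ for $1\le j\le s-1$; with the convention $\pi_0=\infty$, let $a_j$ be the largest non-negative integer $a$ with $\pi_a\ge a-c_j$, and $b_j=a_j-c_j$; put $a_0=0$, $a_s=\infty$, $b_0=\infty$, $b_s=0$ (one has $a_1\le\cdots\le a_{s-1}$ and $b_1\ge\cdots\ge b_{s-1}\ge0$). Then $\eta'_j=\eta_j-(a_j-a_{j-1})$ for $1\le j\le s-1$, $\eta'_s=\eta_{s+1}+b_{s-1}$, and $\pi^j$ is given by $\pi^j_{k-a_{j-1}}=\pi_k-b_j$ for $a_{j-1}<k\le a_j$ (further terms zero). One has $\eta'_2\ge\cdots\ge\eta'_{s-1}$. The map $\Phi_{\lambda,\mu}$. Given $(\pi(1),\ldots,\pi(r))$ in $\mathscr{P}_r(d)$, put $\lambda^{r+1}=\lambda$ and, for $j=r,r-1,\ldots,1$ successively, $(\lambda^j,\pi(j)^1,\ldots,\pi(j)^j)=\Xi_{\lambda^{j+1}}(\mu_{j+1},\pi(j))$. Then $\Phi_{\lambda,\mu}(\pi(1),\ldots,\pi(r))$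 is the array of integer sequences $\lambda^1,\ldots,\lambda^{r+1}$ ($\lambda^j$ of length $j$) together with the partitions $\pi(j)^i$, $1\le i\le j\le r$. Shift. The shift by $k$ of a sequence $\eta_1,\ldots,\eta_{s+1}$ is the sequence $\tilde\eta$ with $\tilde\eta_1=\eta_1+2k$, $\tilde\eta_j=\eta_j+k$ for $2\le j\le s$, $\tilde\eta_{s+1}=\eta_{s+1}$ if $s\ge1$, and $\tilde\eta_1=\eta_1+k$ if $s=0$. The operator $\mathcal{S}^k$ replaces every sequence of an array by its shift by $k$ and leaves the partitions $\pi(j)^i$ unchanged. *)

theory Defs
  imports Main
begin

text \<open>Finite sequences are lists, but indices are written from 1 on.\<close>

abbreviation nth1 :: "'a list \<Rightarrow> nat \<Rightarrow> 'a"  (infixl "!\<^sub>1" 100) where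
  "xs !\<^sub>1 i \<equiv> xs ! (i - 1)"

abbreviation non_increasing :: "int list \<Rightarrow> bool" where
  "non_increasing \<equiv> sorted_wrt (\<ge>)"

subsection \<open>Partitions\<close>

text \<open>The partition \<open>\<pi>\<^sub>1 \<ge> \<pi>\<^sub>2 \<ge> \<dots>\<close> is the function \<open>n \<mapsto> \<pi>\<^sub>n\<^sub>+\<^sub>1\<close>; \<open>part p k\<close> is
  \<open>\<pi>\<^sub>k\<close> and is meaningful only for \<open>k \<ge> 1\<close>.\<close>

type_synonym parts = "nat \<Rightarrow> nat"

definition is_partition :: "parts \<Rightarrow> bool" where
  "is_partition p \<longleftrightarrow> antimono p \<and> (\<exists>N. \<forall>n\<ge>N. p n = 0)"

definition part :: "parts \<Rightarrow> nat \<Rightarrow> nat" where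
  "part p k = p (k - 1)"

definition psize :: "parts \<Rightarrow> nat" where
  "psize p = (\<Sum>n | p n \<noteq> 0. p n)"

definition fits_into :: "parts \<Rightarrow> int \<Rightarrow> int \<Rightarrow> bool" where
  "fits_into p a b \<longleftrightarrow>
     int (card {n. p n \<noteq> 0}) \<le> a \<and> (\<forall>n. p n \<noteq> 0 \<longrightarrow> int (p n) \<le> b)"

definition colored_partitions :: "nat \<Rightarrow> nat \<Rightarrow> parts list set" where
  "colored_partitions r d =
     {ps. length ps = r \<and> (\<forall>p\<in>set ps. is_partition p) \<and> sum_list (map psize ps) = d}"

subsection \<open>Majorization\<close>

definition sum_largest :: "nat \<Rightarrow> 'a::linordered_ab_group_add list \<Rightarrow> 'a" where
  "sum_largest k x = sum_list (take k (rev (sort x)))"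

definition majorizes :: "'a::linordered_ab_group_add list \<Rightarrow> 'a list \<Rightarrow> bool" where
  "majorizes x y \<longleftrightarrow> length x = length y \<and>
     (\<forall>k\<in>{1..length x}. sum_largest k x \<ge> sum_largest k y) \<and>
     sum_largest (length x) x = sum_largest (length x) y"

subsection \<open>Gelfand-Tsetlin patterns and partition overlaid patterns\<close>

text \<open>An array is a pair \<open>(L, Q)\<close> with \<open>L !\<^sub>1 j\<close> the sequence \<open>\<lambda>\<^sup>j\<close> and
  \<open>Q !\<^sub>1 j !\<^sub>1 i\<close> the partition \<open>\<pi>(j)\<^sup>i\<close>.\<close>

type_synonym pattern_array = "int list list \<times> parts list list"

definition interlace :: "int list \<Rightarrow> int list \<Rightarrow> bool" where
  "interlace la mu \<longleftrightarrow> length la = length mu + 1 \<and>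
     (\<forall>i\<in>{1..length mu}. la !\<^sub>1 i \<ge> mu !\<^sub>1 i \<and> mu !\<^sub>1 i \<ge> la !\<^sub>1 (i + 1))"

definition integral_GT_pattern :: "nat \<Rightarrow> int list list \<Rightarrow> bool" where
  "integral_GT_pattern r L \<longleftrightarrow> length L = r + 1 \<and>
     (\<forall>j\<in>{1..r+1}. length (L !\<^sub>1 j) = j \<and> non_increasing (L !\<^sub>1 j)) \<and>
     (\<forall>j\<in>{1..r}. interlace (L !\<^sub>1 (j + 1)) (L !\<^sub>1 j))"

definition bounding_sequence :: "nat \<Rightarrow> int list list \<Rightarrow> int list" where
  "bounding_sequence r L = L !\<^sub>1 (r + 1)"

definition row_sum :: "int list list \<Rightarrow> nat \<Rightarrow> int" where
  "row_sum L j = (if j = 0 then 0 else sum_list (L !\<^sub>1 j))"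

definition weight :: "nat \<Rightarrow> int list list \<Rightarrow> int list" where
  "weight r L = map (\<lambda>j. row_sum L j - row_sum L (j - 1)) [1..<r + 2]"

definition is_POP :: "nat \<Rightarrow> pattern_array \<Rightarrow> bool" where
  "is_POP r = (\<lambda>(L, Q). integral_GT_pattern r L \<and> length Q = r \<and>
     (\<forall>j\<in>{1..r}. length (Q !\<^sub>1 j) = j \<and>
       (\<forall>i\<in>{1..j}. is_partition (Q !\<^sub>1 j !\<^sub>1 i) \<and>
         fits_into (Q !\<^sub>1 j !\<^sub>1 i)
           (L !\<^sub>1 (j + 1) !\<^sub>1 i - L !\<^sub>1 j !\<^sub>1 i)
           (L !\<^sub>1 j !\<^sub>1 i - L !\<^sub>1 (j + 1) !\<^sub>1 (i + 1)))))"

definition proper_area :: "nat \<Rightarrow> int list list \<Rightarrow> int" where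
  "proper_area r L = (\<Sum>j=2..r. \<Sum>i=1..j. \<Sum>h=i+1..j.
     (L !\<^sub>1 (j + 1) !\<^sub>1 i - L !\<^sub>1 j !\<^sub>1 i) * (L !\<^sub>1 j !\<^sub>1 h - L !\<^sub>1 (j + 1) !\<^sub>1 (h + 1)))"

definition overlay_size :: "nat \<Rightarrow> parts list list \<Rightarrow> nat" where
  "overlay_size r Q = (\<Sum>j=1..r. \<Sum>i=1..j. psize (Q !\<^sub>1 j !\<^sub>1 i))"

subsection \<open>The map Xi\<close>

text \<open>For \<open>\<eta>\<close> of length \<open>s + 1\<close> with \<open>s \<ge> 2\<close>, the following three functions give
  \<open>c\<^sub>j\<close>, \<open>a\<^sub>j\<close>, \<open>b\<^sub>j\<close> for \<open>1 \<le> j \<le> s - 1\<close>, and \<open>a\<^sub>0 = 0\<close>.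
  The disjunct \<open>a = 0\<close> is the convention \<open>\<pi>\<^sub>0 = \<infinity>\<close>; the convention \<open>a\<^sub>s = \<infinity>\<close>,
  \<open>b\<^sub>s = 0\<close> is the case \<open>j = s\<close> in \<open>Xi_part\<close>.\<close>

definition Xi_c :: "int list \<Rightarrow> int \<Rightarrow> nat \<Rightarrow> int" where
  "Xi_c \<eta> m j = m - \<eta> !\<^sub>1 (j + 1)"

definition Xi_a :: "int list \<Rightarrow> int \<Rightarrow> parts \<Rightarrow> nat \<Rightarrow> nat" where
  "Xi_a \<eta> m p j =
     (if j = 0 then 0
      else GREATEST a. a = 0 \<or> int (part p a) \<ge> int a - Xi_c \<eta> m j)"

definition Xi_b :: "int list \<Rightarrow> int \<Rightarrow> parts \<Rightarrow> nat \<Rightarrow> int" where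
  "Xi_b \<eta> m p j = int (Xi_a \<eta> m p j) - Xi_c \<eta> m j"

definition Xi_seq :: "int list \<Rightarrow> int \<Rightarrow> parts \<Rightarrow> nat \<Rightarrow> int" where
  "Xi_seq \<eta> m p j = (let s = length \<eta> - 1 in
     if j < s then \<eta> !\<^sub>1 j - (int (Xi_a \<eta> m p j) - int (Xi_a \<eta> m p (j - 1)))
     else \<eta> !\<^sub>1 (s + 1) + Xi_b \<eta> m p (s - 1))"

text \<open>Below, \<open>n + 1\<close> is the index \<open>k - a\<^sub>j\<^sub>-\<^sub>1\<close> of the part of \<open>\<pi>\<^sup>j\<close>. The subtraction on
  natural numbers never truncates, as \<open>\<pi>\<^sub>k \<ge> b\<^sub>j \<ge> 0\<close> for \<open>1 \<le> k \<le> a\<^sub>j\<close>.\<close>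

definition Xi_part :: "int list \<Rightarrow> int \<Rightarrow> parts \<Rightarrow> nat \<Rightarrow> parts" where
  "Xi_part \<eta> m p j = (\<lambda>n. let s = length \<eta> - 1; k = n + 1 + Xi_a \<eta> m p (j - 1) in
     if j = s then part p k
     else if k \<le> Xi_a \<eta> m p j then part p k - nat (Xi_b \<eta> m p j)
     else 0)"

definition Xi :: "int list \<Rightarrow> int \<Rightarrow> parts \<Rightarrow> int list \<times> parts list" where
  "Xi \<eta> m p = (let s = length \<eta> - 1 in
     if s = 1 then ([\<eta> !\<^sub>1 1 + \<eta> !\<^sub>1 2 - m], [p])
     else (map (Xi_seq \<eta> m p) [1..<s + 1], map (Xi_part \<eta> m p) [1..<s + 1]))"

subsection \<open>The map Phi and the shift\<close>

text \<open>\<open>Phi_upto \<mu> ps j \<eta>\<close> is the array built by the steps \<open>j, j - 1, \<dots>, 1\<close>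
  from \<open>\<lambda>\<^sup>j\<^sup>+\<^sup>1 = \<eta>\<close>.\<close>

fun Phi_upto :: "int list \<Rightarrow> parts list \<Rightarrow> nat \<Rightarrow> int list \<Rightarrow> pattern_array" where
  "Phi_upto \<mu> ps 0 \<eta> = ([\<eta>], [])"
| "Phi_upto \<mu> ps (Suc j) \<eta> =
     (let (\<eta>', qs) = Xi \<eta> (\<mu> !\<^sub>1 (Suc j + 1)) (ps !\<^sub>1 Suc j);
          (L, Q) = Phi_upto \<mu> ps j \<eta>'
      in (L @ [\<eta>], Q @ [qs]))"

definition Phi :: "int list \<Rightarrow> int list \<Rightarrow> parts list \<Rightarrow> pattern_array" where
  "Phi la \<mu> ps = Phi_upto \<mu> ps (length ps) la"

definition shift_seq :: "int \<Rightarrow> int list \<Rightarrow> int list" where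
  "shift_seq k \<eta> = (let s = length \<eta> - 1 in
     if s = 0 then map (\<lambda>x. x + k) \<eta>
     else map (\<lambda>j. if j = 1 then \<eta> !\<^sub>1 1 + 2 * k
                   else if j \<le> s then \<eta> !\<^sub>1 j + k
                   else \<eta> !\<^sub>1 j) [1..<s + 2])"

definition shift_array :: "int \<Rightarrow> pattern_array \<Rightarrow> pattern_array" where
  "shift_array k = (\<lambda>(L, Q). (map (shift_seq k) L, Q))"

definition shifted_POPs :: "nat \<Rightarrow> int list \<Rightarrow> int list \<Rightarrow> int \<Rightarrow> nat \<Rightarrow> pattern_array set" where
  "shifted_POPs r la \<mu> k d = {(L, Q). is_POP r (L, Q) \<and>
     bounding_sequence r L = shift_seq k la \<and>
     weight r L = map (\<lambda>m. m + k) \<mu> \<and>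
     proper_area r L + int (overlay_size r Q) = int d}"

end

theory Submission
  imports "HOL-Library.Multiset" Defs
begin

text \<open>The corners \<open>(a\<^sub>j, b\<^sub>j)\<close> on the boundary of the diagram of \<open>\<pi>\<close> cut out, for each \<open>i < h\<close>, the rectangle
  with sides \<open>a\<^sub>i - a\<^sub>i\<^sub>-\<^sub>1\<close> and \<open>b\<^sub>h\<^sub>-\<^sub>1 - b\<^sub>h\<close>, and what remains is \<open>\<pi>\<^sup>1, \<dots>, \<pi>\<^sup>s\<close>; so \<open>|\<pi>|\<close> is the
  proper trapezoidal area of the two rows plus \<open>\<Sum> |\<pi>\<^sup>j|\<close>. Conversely the two rows determine the corners,
  and gluing the \<open>\<pi>\<^sup>j\<close> along them recovers \<open>\<pi>\<close>; this inverts \<open>\<Phi>\<close> row by row on any POP.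
  That \<open>\<Phi>\<close> lands in POPs only has to be checked at the two ends of each row. There one carries
  along that each row majorizes the remaining weight up to the total size \<open>e\<close> of the partitions
  already used: since \<open>a\<^sub>j \<le> |\<pi>| + max(0, c\<^sub>j)\<close>, a step raises the defect by at most \<open>|\<pi>|\<close>, and
  \<open>e \<le> d \<le> k\<close> throughout.\<close>

subsection \<open>Partitions\<close>

lemma is_partition_antimono: "is_partition p \<Longrightarrow> i \<le> j \<Longrightarrow> p j \<le> p i"
  unfolding is_partition_def by (blast dest: antimonoD)

lemma is_partitionI:
  assumes "\<And>i j. i \<le> j \<Longrightarrow> p j \<le> p i" and "\<And>n. n \<ge> N \<Longrightarrow> p n = 0"
  shows "is_partition p"
  unfolding is_partition_def using assms by (blast intro: antimonoI)

lemma psize_eq_sum: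
  assumes "\<And>n. n \<ge> N \<Longrightarrow> p n = 0"
  shows "psize p = (\<Sum>n<N. p n)"
  unfolding psize_def by (rule sum.mono_neutral_left) (use assms in \<open>auto intro: leI ccontr\<close>)

lemma sum_le_psize:
  assumes "is_partition p"
  shows "(\<Sum>n<N. p n) \<le> psize p"
proof -
  obtain M where M: "\<And>n. n \<ge> M \<Longrightarrow> p n = 0"
    using assms unfolding is_partition_def by blast
  then have "psize p = (\<Sum>n<max M N. p n)"
    by (intro psize_eq_sum) simp
  moreover have "(\<Sum>n<N. p n) \<le> (\<Sum>n<max M N. p n)"
    by (rule sum_mono2) auto
  ultimately show ?thesis by simp
qed

lemma part_le_psize: "is_partition p \<Longrightarrow> p n \<le> psize p"
  using sum_le_psize[of p "Suc n"] by simp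

text \<open>The parts with indices 0 to n are all at least 1, so the number of parts is at most the
  size. Together with \<open>part_le_psize\<close> this later shows that the two end rectangles of
  each row are large enough.\<close>

lemma le_psize_of_nonzero:
  assumes "is_partition p" and "p n \<noteq> 0"
  shows "Suc n \<le> psize p"
proof -
  have "(\<Sum>i<Suc n. 1) \<le> (\<Sum>i<Suc n. p i)"
    using is_partition_antimono[OF assms(1), of _ n] assms(2)
    by (intro sum_mono) (metis One_nat_def Suc_leI gr0I le_zero_eq less_Suc_eq_le lessThan_iff)
  also have "\<dots> \<le> psize p" by (rule sum_le_psize[OF assms(1)])
  finally show ?thesis by simp
qed

text \<open>Terms are non-increasing, so at most N of them are non-zero iff the term with 0-based
  index N vanishes, and \<open>p 0\<close> is the largest part. The conjunct
  \<open>a \<ge> 0\<close> compensates for the truncation of \<open>nat\<close>; an empty partition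
  puts no condition on \<open>b\<close>.\<close>

lemma fits_into_iff:
  assumes "is_partition p"
  shows "fits_into p a b \<longleftrightarrow> a \<ge> 0 \<and> p (nat a) = 0 \<and> (p 0 = 0 \<or> int (p 0) \<le> b)"
proof -
  obtain M where "\<And>n. n \<ge> M \<Longrightarrow> p n = 0"
    using assms unfolding is_partition_def by blast
  then have "{n. p n \<noteq> 0} \<subseteq> {..<M}" by (auto intro: leI ccontr)
  then have fin: "finite {n. p n \<noteq> 0}" by (rule finite_subset) simp
  have "card {n. p n \<noteq> 0} \<le> N \<longleftrightarrow> p N = 0" for N
  proof
    assume "p N = 0"
    then have "{n. p n \<noteq> 0} \<subseteq> {..<N}"
      using is_partition_antimono[OF assms, of N]
      by (metis (mono_tags, lifting) bot_nat_0.extremum_unique lessThan_iff linorder_not_le mem_Collect_eq subsetI)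
    then show "card {n. p n \<noteq> 0} \<le> N"
      using card_mono[OF finite_lessThan] by fastforce
  next
    assume *: "card {n. p n \<noteq> 0} \<le> N"
    show "p N = 0"
    proof (rule ccontr)
      assume "p N \<noteq> 0"
      then have "{..N} \<subseteq> {n. p n \<noteq> 0}"
        using is_partition_antimono[OF assms, of _ N] by fastforce
      from card_mono[OF fin this] * show False by simp
    qed
  qed
  moreover have "int (card {n. p n \<noteq> 0}) \<le> a \<longleftrightarrow> a \<ge> 0 \<and> card {n. p n \<noteq> 0} \<le> nat a"
    by linarith
  moreover have "(\<forall>n. p n \<noteq> 0 \<longrightarrow> int (p n) \<le> b) \<longleftrightarrow> p 0 = 0 \<or> int (p 0) \<le> b"
    using is_partition_antimono[OF assms, of 0] by (metis le0 le_zero_eq of_nat_mono order_trans)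
  ultimately show ?thesis unfolding fits_into_def by simp
qed

subsection \<open>Corners\<close>

lemma Xi_a_0 [simp]: "Xi_a \<eta> m p 0 = 0"
  by (simp add: Xi_a_def)

text \<open>\<open>lo\<close> says that \<open>a\<close> satisfies the defining condition,
  \<open>up\<close> that \<open>a + 1\<close> fails it (\<open>part p (a + 1)\<close> is
  \<open>p a\<close>). As the parts do not grow while the right-hand side does, no larger value
  qualifies.\<close>

lemma Xi_a_eqI:
  assumes p: "is_partition p" and j: "j \<ge> 1"
    and lo: "a = 0 \<or> int (p (a - 1)) \<ge> int a - Xi_c \<eta> m j"
    and up: "int (p a) \<le> int a - Xi_c \<eta> m j"
  shows "Xi_a \<eta> m p j = a"
proof -
  have "y \<le> a" if y: "y = 0 \<or> int (part p y) \<ge> int y - Xi_c \<eta> m j" for y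
  proof (rule ccontr)
    assume "\<not> y \<le> a"
    then have "p (y - 1) \<le> p a" by (intro is_partition_antimono[OF p]) simp
    then show False using y up \<open>\<not> y \<le> a\<close> by (auto simp: part_def)
  qed
  then have "(GREATEST a. a = 0 \<or> int (part p a) \<ge> int a - Xi_c \<eta> m j) = a"
    using lo by (intro Greatest_equality) (auto simp: part_def)
  with j show ?thesis by (simp add: Xi_a_def)
qed

text \<open>The point \<open>(a_j, b_j)\<close> is where the boundary of the diagram meets the
  diagonal \<open>a - b = c_j\<close>. The lower bound on the rows before it is the defining
  condition at \<open>a_j\<close>, the upper bound on the later rows is its failure at
  \<open>a_j + 1\<close>.\<close>

lemma Xi_corner:
  assumes p: "is_partition p" and j: "j \<ge> 1"
  shows Xi_b_le: "n < Xi_a \<eta> m p j \<Longrightarrow> Xi_b \<eta> m p j \<le> int (p n)"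
    and le_Xi_b: "n \<ge> Xi_a \<eta> m p j \<Longrightarrow> int (p n) \<le> Xi_b \<eta> m p j"
    and Xi_b_nonneg: "Xi_b \<eta> m p j \<ge> 0"
proof -
  let ?P = "\<lambda>a. a = 0 \<or> int (p (a - 1)) \<ge> int a - Xi_c \<eta> m j"
  \<comment> \<open>Candidates are bounded, so the maximum denoted by \<open>GREATEST\<close>
    exists.\<close>
  have bound: "a \<le> nat (int (p 0) + \<bar>Xi_c \<eta> m j\<bar>)" if "?P a" for a
    using that is_partition_antimono[OF p, of 0 "a - 1"] by linarith
  let ?a = "GREATEST a. ?P a"
  have P: "?P ?a" by (rule GreatestI_nat[of ?P 0, OF _ bound]) auto
  have nP: "\<not> ?P (Suc ?a)"
  proof
    assume "?P (Suc ?a)"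
    from Greatest_le_nat[of ?P, OF this bound] show False by simp
  qed
  have a: "Xi_a \<eta> m p j = ?a" using P nP by (intro Xi_a_eqI[OF p j]) auto
  show 2: "int (p n) \<le> Xi_b \<eta> m p j" if "n \<ge> Xi_a \<eta> m p j" for n
    using nP is_partition_antimono[OF p that] unfolding Xi_b_def a by auto
  show "Xi_b \<eta> m p j \<le> int (p n)" if "n < Xi_a \<eta> m p j"
  proof -
    have "p (?a - 1) \<le> p n" using that a by (intro is_partition_antimono[OF p]) simp
    then show ?thesis using P that unfolding Xi_b_def a by auto
  qed
  show "Xi_b \<eta> m p j \<ge> 0" using 2[of "Xi_a \<eta> m p j"] by simp
qed

lemma Xi_c_eq: "Xi_c \<eta> m j = int (Xi_a \<eta> m p j) - Xi_b \<eta> m p j"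
  by (simp add: Xi_b_def)

text \<open>If \<open>a_i > a_j\<close>, then row \<open>a_j\<close> of the diagram has length at
  least \<open>b_i\<close> and at most \<open>b_j\<close>; hence
  \<open>c_i = a_i - b_i > a_j - b_j = c_j\<close>, a contradiction. The claim on \<open>b\<close>
  follows in the same way from row \<open>a_i\<close>.\<close>

lemma Xi_a_mono:
  assumes p: "is_partition p" and j: "i \<ge> 1" "j \<ge> 1" and c: "Xi_c \<eta> m i \<le> Xi_c \<eta> m j"
  shows "Xi_a \<eta> m p i \<le> Xi_a \<eta> m p j" and "Xi_b \<eta> m p j \<le> Xi_b \<eta> m p i"
proof -
  show a: "Xi_a \<eta> m p i \<le> Xi_a \<eta> m p j"
    using c Xi_b_le[OF p j(1), of "Xi_a \<eta> m p j" \<eta> m] le_Xi_b[OF p j(2), of \<eta> m "Xi_a \<eta> m p j"]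
      Xi_c_eq[of \<eta> m i p] Xi_c_eq[of \<eta> m j p] by linarith
  show "Xi_b \<eta> m p j \<le> Xi_b \<eta> m p i"
    using a c Xi_b_le[OF p j(2), of "Xi_a \<eta> m p i" \<eta> m] le_Xi_b[OF p j(1), of \<eta> m "Xi_a \<eta> m p i"]
      Xi_c_eq[of \<eta> m i p] Xi_c_eq[of \<eta> m j p] by linarith
qed

text \<open>If \<open>a_j\<close> and \<open>b_j\<close> are positive, the row just before index
  \<open>a_j\<close> is non-zero, so \<open>a_j\<close> is at most |p|; if \<open>b_j = 0\<close>,
  then \<open>a_j = c_j\<close>. This estimate controls the growth of the majorization
  defect.\<close>

lemma Xi_a_le:
  assumes p: "is_partition p" and j: "j \<ge> 1"
  shows "int (Xi_a \<eta> m p j) \<le> int (psize p) + max 0 (Xi_c \<eta> m j)"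
proof (cases "Xi_a \<eta> m p j = 0 \<or> Xi_b \<eta> m p j = 0")
  case True
  then show ?thesis using Xi_c_eq[of \<eta> m j p] by auto
next
  case False
  then have "p (Xi_a \<eta> m p j - 1) \<noteq> 0"
    using Xi_b_le[OF p j, of "Xi_a \<eta> m p j - 1" \<eta> m] Xi_b_nonneg[OF p j, of \<eta> m] by linarith
  from le_psize_of_nonzero[OF p this] False show ?thesis by linarith
qed

subsection \<open>Shifts\<close>

lemma length_shift_seq [simp]: "length (shift_seq k \<eta>) = length \<eta>"
  by (cases \<eta>) (auto simp: shift_seq_def Let_def simp del: upt_Suc)

lemma shift_seq_nth1:
  assumes "length \<eta> = s + 1" and "s \<ge> 1" and "1 \<le> i" and "i \<le> s + 1"
  shows "shift_seq k \<eta> !\<^sub>1 i = \<eta> !\<^sub>1 i + (if i = 1 then 2 * k else if i \<le> s then k else 0)"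
  using assms by (auto simp: shift_seq_def Let_def simp del: upt_Suc)

text \<open>The increments 2k, k, ..., k, 0 cancel between adjacent rows, except in the last left
  difference and the first right difference, each of which gains k.\<close>

lemma shift_seq_diff:
  assumes \<eta>: "length \<eta> = s + 1" and \<eta>': "length \<eta>' = s" and i: "1 \<le> i" "i \<le> s"
  shows shift_seq_diff_left: "shift_seq k \<eta> !\<^sub>1 i - shift_seq k \<eta>' !\<^sub>1 i
      = \<eta> !\<^sub>1 i - \<eta>' !\<^sub>1 i + (if i = s then k else 0)"
    and shift_seq_diff_right: "shift_seq k \<eta>' !\<^sub>1 i - shift_seq k \<eta> !\<^sub>1 (i + 1)
      = \<eta>' !\<^sub>1 i - \<eta> !\<^sub>1 (i + 1) + (if i = 1 then k else 0)"
proof -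
  \<comment> \<open>The shorter row has length t + 1; for t = 0 the shift has a separate clause,
    whence the case \<open>s = 1\<close> in the next formula.\<close>
  obtain t where s: "s = t + 1" using i by (metis add.commute le_Suc_ex le_trans)
  have *: "shift_seq k \<eta>' !\<^sub>1 i = \<eta>' !\<^sub>1 i +
      (if s = 1 then k else if i = 1 then 2 * k else if i < s then k else 0)"
  proof (cases "s = 1")
    case True
    then show ?thesis using \<eta>' i by (simp add: shift_seq_def)
  next
    case False
    then show ?thesis using shift_seq_nth1[of \<eta>' t i k] \<eta>' i s by auto
  qed
  show "shift_seq k \<eta> !\<^sub>1 i - shift_seq k \<eta>' !\<^sub>1 i
      = \<eta> !\<^sub>1 i - \<eta>' !\<^sub>1 i + (if i = s then k else 0)"
    using shift_seq_nth1[OF \<eta>, of i k] i unfolding * by auto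
  show "shift_seq k \<eta>' !\<^sub>1 i - shift_seq k \<eta> !\<^sub>1 (i + 1)
      = \<eta>' !\<^sub>1 i - \<eta> !\<^sub>1 (i + 1) + (if i = 1 then k else 0)"
    using shift_seq_nth1[OF \<eta>, of "i + 1" k] i unfolding * by auto
qed

lemma sum_list_nth1: "sum_list xs = (\<Sum>i=1..length xs. xs !\<^sub>1 i)"
  for xs :: "int list"
  by (simp add: sum_list_sum_nth sum.atLeast_Suc_atMost_Suc_shift atLeast0LessThan
      lessThan_Suc_atMost sum.atLeast1_atMost_eq)

text \<open>The increments add up to 2k + (s - 1)k, which is k per entry. The sums of adjacent rows
  thus move apart by k, so every weight entry rises by k.\<close>

lemma sum_list_shift_seq:
  assumes "\<eta> \<noteq> []"
  shows "sum_list (shift_seq k \<eta>) = sum_list \<eta> + int (length \<eta>) * k"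
proof (cases "length \<eta> = 1")
  case True
  then obtain x where "\<eta> = [x]" by (auto simp: length_Suc_conv)
  then show ?thesis by (simp add: shift_seq_def)
next
  case False
  then obtain s where s: "length \<eta> = s + 1" "s \<ge> 1"
    using assms by (metis One_nat_def Suc_eq_plus1 Suc_leI length_greater_0_conv less_one linorder_neqE_nat not_less_eq old.nat.exhaust zero_less_iff_neq_zero)
  have "sum_list (shift_seq k \<eta>) = (\<Sum>i=1..s+1. \<eta> !\<^sub>1 i + (if i = 1 then 2 * k else if i \<le> s then k else 0))"
    unfolding sum_list_nth1 length_shift_seq s(1) using shift_seq_nth1[OF s] by (intro sum.cong) auto
  also have "\<dots> = sum_list \<eta> + (\<Sum>i=1..s+1. if i = 1 then 2 * k else if i \<le> s then k else 0)"
    unfolding sum.distrib sum_list_nth1 s(1) ..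
  also have "(\<Sum>i=1..s+1. if i = 1 then 2 * k else if i \<le> s then k else 0)
      = 2 * k + (\<Sum>i=2..s. k)"
    using s(2) by (simp add: sum.atLeast_Suc_atMost numeral_2_eq_2)
  finally show ?thesis using s by (simp add: algebra_simps of_nat_diff)
qed

text \<open>This gives injectivity of the shift and lets every row of a given POP be written as a
  shifted row.\<close>

lemma shift_seq_uminus [simp]: "shift_seq k (shift_seq (- k) \<eta>) = \<eta>"
proof (cases "length \<eta> \<le> 1")
  case True
  then show ?thesis by (cases \<eta>) (simp_all add: shift_seq_def)
next
  case False
  then obtain s where "length \<eta> = s + 1" "s \<ge> 1"
    by (metis Suc_eq_plus1 Suc_le_mono add_diff_cancel_right' le_SucI nat_le_linear not_less_eq_eq One_nat_def Suc_diff_1 linorder_not_le zero_less_Suc)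
  then show ?thesis
    using shift_seq_nth1[of \<eta> s "Suc _" "- k"] shift_seq_nth1[of "shift_seq (- k) \<eta>" s "Suc _" k]
    by (intro nth_equalityI) auto
qed

lemma inj_shift_seq: "shift_seq k \<eta> = shift_seq k \<eta>' \<Longrightarrow> \<eta> = \<eta>'"
  using shift_seq_uminus[of "- k"] by (metis minus_minus)

lemma non_increasing_nth1: "non_increasing x \<Longrightarrow> 1 \<le> i \<Longrightarrow> i \<le> j \<Longrightarrow> j \<le> length x \<Longrightarrow> x !\<^sub>1 j \<le> x !\<^sub>1 i"
  by (cases "i = j") (auto intro: sorted_wrt_nth_less[of "(\<ge>)"])

text \<open>An entry of \<open>x\<close> lies between any two consecutive entries of
  \<open>y\<close>. Interlacing with the row above therefore passes monotonicity down the
  array.\<close>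

lemma interlace_imp_non_increasing:
  assumes "interlace x y" shows "non_increasing y"
  unfolding sorted_wrt_iff_nth_Suc_transp[OF transp_on_ge]
proof (intro allI impI)
  fix i assume "Suc i < length y"
  moreover have "\<forall>i\<in>{1..length y}. x !\<^sub>1 i \<ge> y !\<^sub>1 i \<and> y !\<^sub>1 i \<ge> x !\<^sub>1 (i + 1)"
    using assms by (simp add: interlace_def)
  from bspec[OF this, of "i + 1"] bspec[OF this, of "i + 2"]
  calculation show "y ! i \<ge> y ! Suc i" by simp
qed

subsection \<open>One step of the construction\<close>

lemma Xi_one:
  assumes "length \<eta> = 2"
  shows "Xi \<eta> m p = ([\<eta> !\<^sub>1 1 + \<eta> !\<^sub>1 2 - m], [p])"
  using assms by (simp add: Xi_def)

lemma
  assumes "length \<eta> = s + 1" and "s \<ge> 1"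
  shows length_fst_Xi: "length (fst (Xi \<eta> m p)) = s"
    and length_snd_Xi: "length (snd (Xi \<eta> m p)) = s"
  using assms by (auto simp: Xi_def simp del: upt_Suc)

lemma
  assumes "length \<eta> = s + 1" and "s \<ge> 2" and "1 \<le> j" and "j \<le> s"
  shows fst_Xi_nth1: "fst (Xi \<eta> m p) !\<^sub>1 j = Xi_seq \<eta> m p j"
    and snd_Xi_nth1: "snd (Xi \<eta> m p) !\<^sub>1 j = Xi_part \<eta> m p j"
  using assms by (auto simp: Xi_def simp del: upt_Suc)

lemma Xi_seq_less:
  "length \<eta> = s + 1 \<Longrightarrow> j < s \<Longrightarrow>
    Xi_seq \<eta> m p j = \<eta> !\<^sub>1 j - (int (Xi_a \<eta> m p j) - int (Xi_a \<eta> m p (j - 1)))"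
  by (simp add: Xi_seq_def)

lemma Xi_seq_last:
  "length \<eta> = s + 1 \<Longrightarrow> Xi_seq \<eta> m p s = \<eta> !\<^sub>1 (s + 1) + Xi_b \<eta> m p (s - 1)"
  by (simp add: Xi_seq_def)

text \<open>Substitute \<open>a_j - b_j = m - \<eta>_{j+1}\<close> into the formula for the entry.
  Differences with the upper row are thus steps of \<open>a\<close> on the left and steps of
  \<open>b\<close> on the right; the \<open>if\<close> is the convention
  \<open>b_s = 0\<close>.\<close>

lemma Xi_seq_greater_1:
  assumes "length \<eta> = s + 1" and "2 \<le> j" and "j \<le> s"
  shows "Xi_seq \<eta> m p j = \<eta> !\<^sub>1 (j + 1) + (Xi_b \<eta> m p (j - 1) - (if j < s then Xi_b \<eta> m p j else 0))"
  using assms Xi_seq_last[OF assms(1)] by (auto simp: Xi_seq_less[OF assms(1)] Xi_b_def Xi_c_def)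

lemma Xi_part_less:
  "length \<eta> = s + 1 \<Longrightarrow> j < s \<Longrightarrow> Xi_part \<eta> m p j n =
    (if n + Xi_a \<eta> m p (j - 1) < Xi_a \<eta> m p j
     then p (n + Xi_a \<eta> m p (j - 1)) - nat (Xi_b \<eta> m p j) else 0)"
  by (auto simp: Xi_part_def part_def Let_def)

lemma Xi_part_last:
  "length \<eta> = s + 1 \<Longrightarrow> Xi_part \<eta> m p s n = p (n + Xi_a \<eta> m p (s - 1))"
  by (simp add: Xi_part_def part_def Let_def)

lemma is_partition_Xi_part:
  assumes p: "is_partition p" and \<eta>: "length \<eta> = s + 1" and j: "1 \<le> j" "j \<le> s"
  shows "is_partition (Xi_part \<eta> m p j)"
proof (cases "j = s")
  case True
  obtain M where "\<And>n. n \<ge> M \<Longrightarrow> p n = 0"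
    using p unfolding is_partition_def by blast
  then show ?thesis unfolding True
    by (intro is_partitionI[where N = M])
      (auto simp: Xi_part_last[OF \<eta>] intro: is_partition_antimono[OF p])
next
  case False
  then have "j < s" using j by simp
  then show ?thesis
    by (intro is_partitionI[where N = "Xi_a \<eta> m p j"])
      (auto simp: Xi_part_less[OF \<eta>] intro!: diff_le_mono is_partition_antimono[OF p])
qed

text \<open>The differences \<open>a_i - a_{i-1}\<close> telescope. In particular the new row
  determines every \<open>a_j\<close>.\<close>

lemma sum_fst_Xi:
  assumes \<eta>: "length \<eta> = s + 1" and s: "s \<ge> 2" and j: "j < s"
  shows "(\<Sum>i=1..j. fst (Xi \<eta> m p) !\<^sub>1 i) = (\<Sum>i=1..j. \<eta> !\<^sub>1 i) - int (Xi_a \<eta> m p j)"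
  using j
proof (induction j)
  case (Suc j)
  then have "fst (Xi \<eta> m p) !\<^sub>1 Suc j =
      \<eta> !\<^sub>1 Suc j - (int (Xi_a \<eta> m p (Suc j)) - int (Xi_a \<eta> m p j))"
    using fst_Xi_nth1[OF \<eta> s, of "Suc j" m p] Xi_seq_less[OF \<eta>, of "Suc j" m p] by simp
  with Suc show ?case by simp
qed simp

text \<open>The first s - 1 entries lose \<open>a_{s-1}\<close> in total and the last one is
  \<open>\<eta>_{s+1} + b_{s-1}\<close>; since \<open>a_{s-1} - b_{s-1} = m - \<eta>_s\<close>, the
  row sum drops by the prescribed weight entry.\<close>

lemma sum_list_fst_Xi:
  assumes \<eta>: "length \<eta> = s + 1" and s: "s \<ge> 1"
  shows "sum_list (fst (Xi \<eta> m p)) = sum_list \<eta> - m"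
proof (cases "s = 1")
  case True
  then show ?thesis using \<eta> by (auto simp: Xi_one length_Suc_conv)
next
  case False
  then obtain t where t: "s = Suc t" "t \<ge> 1" and s2: "s \<ge> 2" using s by (cases s) auto
  have "sum_list (fst (Xi \<eta> m p)) = (\<Sum>i=1..t. fst (Xi \<eta> m p) !\<^sub>1 i) + fst (Xi \<eta> m p) !\<^sub>1 s"
    by (simp add: sum_list_nth1 length_fst_Xi[OF \<eta> s] t)
  also have "(\<Sum>i=1..t. fst (Xi \<eta> m p) !\<^sub>1 i) = (\<Sum>i=1..t. \<eta> !\<^sub>1 i) - int (Xi_a \<eta> m p t)"
    using sum_fst_Xi[OF \<eta> s2, of t] t by simp
  also have "fst (Xi \<eta> m p) !\<^sub>1 s = \<eta> !\<^sub>1 (s + 1) + Xi_b \<eta> m p t"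
    using fst_Xi_nth1[OF \<eta> s2, of s m p] Xi_seq_last[OF \<eta>, of m p] s t by simp
  finally show ?thesis
    unfolding sum_list_nth1 \<eta> by (simp add: t Xi_b_def Xi_c_def)
qed

text \<open>These are the sides of the rectangles that the pieces must fit into. Interior sides are
  differences of corner coordinates; at \<open>i = s\<close> and \<open>i = 1\<close>, where
  \<open>a_s\<close> and \<open>b_0\<close> would be infinite, k enters instead.\<close>

lemma Xi_step_diff:
  assumes \<eta>: "length \<eta> = s + 1" and s: "s \<ge> 2" and i: "1 \<le> i" "i \<le> s"
  shows Xi_diff_left: "i < s \<Longrightarrow> shift_seq k \<eta> !\<^sub>1 i - shift_seq k (fst (Xi \<eta> m p)) !\<^sub>1 i
      = int (Xi_a \<eta> m p i) - int (Xi_a \<eta> m p (i - 1))"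
    and Xi_diff_left_last: "i = s \<Longrightarrow> shift_seq k \<eta> !\<^sub>1 i - shift_seq k (fst (Xi \<eta> m p)) !\<^sub>1 i
      = m - \<eta> !\<^sub>1 (s + 1) + k - int (Xi_a \<eta> m p (s - 1))"
    and Xi_diff_right: "1 < i \<Longrightarrow> shift_seq k (fst (Xi \<eta> m p)) !\<^sub>1 i - shift_seq k \<eta> !\<^sub>1 (i + 1)
      = Xi_b \<eta> m p (i - 1) - (if i < s then Xi_b \<eta> m p i else 0)"
    and Xi_diff_right_1: "i = 1 \<Longrightarrow> shift_seq k (fst (Xi \<eta> m p)) !\<^sub>1 i - shift_seq k \<eta> !\<^sub>1 (i + 1)
      = \<eta> !\<^sub>1 1 - m + k - Xi_b \<eta> m p 1"
proof -
  have s1: "s \<ge> 1" using s by simp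
  note L = length_fst_Xi[OF \<eta> s1, of m p]
  note S = fst_Xi_nth1[OF \<eta> s i, of m p]
  note l = shift_seq_diff_left[OF \<eta> L i, of k, unfolded S]
  note r = shift_seq_diff_right[OF \<eta> L i, of k, unfolded S]
  show "i < s \<Longrightarrow> shift_seq k \<eta> !\<^sub>1 i - shift_seq k (fst (Xi \<eta> m p)) !\<^sub>1 i
      = int (Xi_a \<eta> m p i) - int (Xi_a \<eta> m p (i - 1))"
    unfolding l by (simp add: Xi_seq_less[OF \<eta>])
  show "i = s \<Longrightarrow> shift_seq k \<eta> !\<^sub>1 i - shift_seq k (fst (Xi \<eta> m p)) !\<^sub>1 i
      = m - \<eta> !\<^sub>1 (s + 1) + k - int (Xi_a \<eta> m p (s - 1))"
    unfolding l using s by (simp add: Xi_seq_last[OF \<eta>] Xi_b_def Xi_c_def)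
  show "1 < i \<Longrightarrow> shift_seq k (fst (Xi \<eta> m p)) !\<^sub>1 i - shift_seq k \<eta> !\<^sub>1 (i + 1)
      = Xi_b \<eta> m p (i - 1) - (if i < s then Xi_b \<eta> m p i else 0)"
    unfolding r using i by (simp add: Xi_seq_greater_1[OF \<eta>])
  show "i = 1 \<Longrightarrow> shift_seq k (fst (Xi \<eta> m p)) !\<^sub>1 i - shift_seq k \<eta> !\<^sub>1 (i + 1)
      = \<eta> !\<^sub>1 1 - m + k - Xi_b \<eta> m p 1"
    unfolding r using s by (simp add: Xi_seq_less[OF \<eta>] Xi_b_def Xi_c_def)
qed

section \<open>Interlacing of the new row and fitting of the pieces\<close>

lemma Xi_c_mono_shift:
  assumes "length \<eta> = s + 1" and "s \<ge> 2" and mono: "non_increasing (shift_seq k \<eta>)"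
    and ij: "1 \<le> i" "i \<le> j" "j < s"
  shows "Xi_c \<eta> m i \<le> Xi_c \<eta> m j"
  \<comment> \<open>Both \<open>i + 1\<close> and \<open>j + 1\<close> lie between 2 and s, where
    the shift adds the same k, so the order of the shifted row passes to \<open>\<eta>\<close>
    itself.\<close>
  using non_increasing_nth1[OF mono, of "i + 1" "j + 1"] assms shift_seq_nth1[of \<eta> s "i + 1" k]
    shift_seq_nth1[of \<eta> s "j + 1" k]
  by (simp add: Xi_c_def)

lemma Xi_mono:
  assumes p: "is_partition p" and \<eta>: "length \<eta> = s + 1" "s \<ge> 2"
    and mono: "non_increasing (shift_seq k \<eta>)" and ij: "i \<le> j" "j < s"
  shows Xi_a_le_Xi_a: "Xi_a \<eta> m p i \<le> Xi_a \<eta> m p j"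
    and Xi_b_le_Xi_b: "1 \<le> i \<Longrightarrow> Xi_b \<eta> m p j \<le> Xi_b \<eta> m p i"
proof -
  show "Xi_a \<eta> m p i \<le> Xi_a \<eta> m p j"
    using Xi_a_mono[OF p _ _ Xi_c_mono_shift[OF \<eta> mono _ ij]] ij by (cases "i = 0") auto
  show "1 \<le> i \<Longrightarrow> Xi_b \<eta> m p j \<le> Xi_b \<eta> m p i"
    using Xi_a_mono[OF p _ _ Xi_c_mono_shift[OF \<eta> mono _ ij]] ij by auto
qed

text \<open>Away from the ends everything follows from the order of the corners. For s at least 2
  the bounds on \<open>m\<close> say that \<open>D + a_{s-1}\<close> at \<open>i = s\<close> and
  \<open>E + b_1\<close> at \<open>i = 1\<close> are at least |p|, which bounds both the number of
  parts and the largest part.\<close>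

lemma Xi_interlace:
  assumes p: "is_partition p" and \<eta>: "length \<eta> = s + 1" "s \<ge> 1"
    and mono: "non_increasing (shift_seq k \<eta>)"
    and m: "m \<le> \<eta> !\<^sub>1 1 + k - int (psize p)" "m \<ge> \<eta> !\<^sub>1 (s + 1) - k + int (psize p)"
    and i: "1 \<le> i" "i \<le> s"
  defines "D \<equiv> shift_seq k \<eta> !\<^sub>1 i - shift_seq k (fst (Xi \<eta> m p)) !\<^sub>1 i"
    and "E \<equiv> shift_seq k (fst (Xi \<eta> m p)) !\<^sub>1 i - shift_seq k \<eta> !\<^sub>1 (i + 1)"
    and "q \<equiv> snd (Xi \<eta> m p) !\<^sub>1 i"
  shows "D \<ge> 0" and "E \<ge> 0" and "is_partition q" and "fits_into q D E"
proof -
  have small: "p n = 0" if "n \<ge> psize p" for n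
    using le_psize_of_nonzero[OF p, of n] that by (cases "p n = 0") auto
  have "D \<ge> 0 \<and> E \<ge> 0 \<and> is_partition q \<and> q (nat D) = 0 \<and> (q 0 = 0 \<or> int (q 0) \<le> E)"
  proof (cases "s = 1")
    case True
    with i \<eta> have "i = 1" and X: "Xi \<eta> m p = ([\<eta> !\<^sub>1 1 + \<eta> !\<^sub>1 2 - m], [p])" by (auto simp: Xi_one)
    then have "D = m + k - \<eta> !\<^sub>1 2" "E = \<eta> !\<^sub>1 1 + k - m" "q = p"
      using \<eta> True shift_seq_nth1[OF \<eta>, of 1] shift_seq_nth1[OF \<eta>, of 2]
      by (auto simp: D_def E_def q_def shift_seq_def)
    then show ?thesis
      using p m True part_le_psize[OF p, of 0] by (auto intro!: small)
  next
    case False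
    then have s: "s \<ge> 2" using \<eta> by simp
    note dl = Xi_diff_left[OF \<eta>(1) s i, of k m p, folded D_def]
    note dll = Xi_diff_left_last[OF \<eta>(1) s i, of k m p, folded D_def]
    note dr = Xi_diff_right[OF \<eta>(1) s i, of k m p, folded E_def]
    note dr1 = Xi_diff_right_1[OF \<eta>(1) s i, of k m p, folded E_def]
    have q: "q = Xi_part \<eta> m p i" using snd_Xi_nth1[OF \<eta>(1) s i] by (simp add: q_def)
    have pos: "Xi_b \<eta> m p j \<ge> 0" if "j \<ge> 1" for j using Xi_b_nonneg[OF p that] .
    have D0: "D \<ge> 0"
    proof (cases "i < s")
      case True
      then show ?thesis using dl Xi_a_le_Xi_a[OF p \<eta>(1) s mono, of "i - 1" i m] by simp
    next
      case False
      with i have i_s: "i = s" by simp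
      show ?thesis
      \<comment> \<open>If \<open>b_{s-1} = 0\<close>, then \<open>a_{s-1} = m - \<eta>_s\<close>
        and \<open>D\<close> is the last difference of the shifted row. Otherwise
        \<open>a_{s-1}\<close> is at most |p|.\<close>
      proof (cases "Xi_b \<eta> m p (s - 1) = 0")
        case True
        then show ?thesis
          using dll i_s non_increasing_nth1[OF mono, of s "s + 1"] s \<eta>
            shift_seq_nth1[OF \<eta>, of s k] shift_seq_nth1[OF \<eta>, of "s + 1" k]
          by (simp add: Xi_b_def Xi_c_def)
      next
        case False
        have "int (Xi_a \<eta> m p (s - 1)) \<le> int (psize p)"
        proof (cases "Xi_a \<eta> m p (s - 1) = 0")
          case a: False
          have "p (Xi_a \<eta> m p (s - 1) - 1) \<noteq> 0"
            using Xi_b_le[OF p, of "s - 1" "Xi_a \<eta> m p (s - 1) - 1" \<eta> m] pos[of "s - 1"] a False s by force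
          from le_psize_of_nonzero[OF p this] show ?thesis by simp
        qed simp
        then show ?thesis using dll i_s m by simp
      qed
    qed
    have E0: "E \<ge> 0"
    proof (cases "i = 1")
      case True
      show ?thesis
      \<comment> \<open>Dually, \<open>a_1 = 0\<close> makes \<open>E\<close> the first difference
        of the shifted row; otherwise \<open>b_1\<close> is at most \<open>p 0\<close>, hence at
        most |p|.\<close>
      proof (cases "Xi_a \<eta> m p 1 = 0")
        case a: True
        then show ?thesis
          using dr1 True non_increasing_nth1[OF mono, of 1 2] s \<eta>
            shift_seq_nth1[OF \<eta>, of 1 k] shift_seq_nth1[OF \<eta>, of 2 k]
          by (simp add: Xi_b_def Xi_c_def)
      next
        case a: False
        then show ?thesis
          using dr1 True m Xi_b_le[OF p, of 1 0 \<eta> m] part_le_psize[OF p, of 0] by simp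
      qed
    next
      case False
      then show ?thesis
        using dr i Xi_b_le_Xi_b[OF p \<eta>(1) s mono, of "i - 1" i m] pos[of "i - 1"] by auto
    qed
    have "q (nat D) = 0"
    proof (cases "i < s")
      case True
      then have "nat D + Xi_a \<eta> m p (i - 1) \<ge> Xi_a \<eta> m p i" using dl by linarith
      then show ?thesis using True by (simp add: q Xi_part_less[OF \<eta>(1)])
    next
      case False
      with i have i_s: "i = s" by simp
      then have "nat D + Xi_a \<eta> m p (s - 1) \<ge> psize p" using dll i_s D0 m by simp
      then show ?thesis unfolding q i_s Xi_part_last[OF \<eta>(1)] by (rule small)
    qed
    moreover have "q 0 = 0 \<or> int (q 0) \<le> E"
    proof (cases "i = 1")
      case True
      then show ?thesis
        using dr1 m Xi_part_less[OF \<eta>(1), of 1 m p 0] q s part_le_psize[OF p, of 0] pos[of 1]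
          Xi_b_le[OF p, of 1 0 \<eta> m]
        by (auto simp: of_nat_diff nat_le_iff)
    next
      case False
      \<comment> \<open>A non-empty piece starts with row \<open>a_{i-1}\<close> less
        \<open>b_i\<close>, and the corner before it bounds that row by
        \<open>b_{i-1}\<close>.\<close>
      then have "int (p (Xi_a \<eta> m p (i - 1))) \<le> Xi_b \<eta> m p (i - 1)"
        using le_Xi_b[OF p, of "i - 1"] i by simp
      then show ?thesis
        using False i dr pos[of i] Xi_part_less[OF \<eta>(1), of i m p 0] Xi_part_last[OF \<eta>(1), of m p 0] q
          Xi_b_le[OF p i(1), of "Xi_a \<eta> m p (i - 1)" \<eta> m]
        by (cases "i = s") (auto simp: of_nat_diff nat_le_iff)
    qed
    ultimately show ?thesis
      using D0 E0 is_partition_Xi_part[OF p \<eta>(1) i] q by simp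
  qed
  then show "D \<ge> 0" "E \<ge> 0" "is_partition q" "fits_into q D E"
    using fits_into_iff[of q D E] by auto
qed

section \<open>Size of a partition as row area plus sizes of its pieces\<close>

definition row_area :: "int list \<Rightarrow> int list \<Rightarrow> int" where
  "row_area la mu = (\<Sum>i=1..length mu. \<Sum>h=i+1..length mu.
     (la !\<^sub>1 i - mu !\<^sub>1 i) * (mu !\<^sub>1 h - la !\<^sub>1 (h + 1)))"

text \<open>For h > 1 the right difference is \<open>b_{h-1} - b_h\<close>, so the sum over h > i
  telescopes to \<open>b_i\<close>: the rectangles of block i together form one with sides
  \<open>a_i - a_{i-1}\<close> and \<open>b_i\<close>.\<close>

lemma row_area_Xi:
  assumes \<eta>: "length \<eta> = s + 1" and s: "s \<ge> 2"
  shows "row_area (shift_seq k \<eta>) (shift_seq k (fst (Xi \<eta> m p)))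
    = (\<Sum>i=1..s-1. (int (Xi_a \<eta> m p i) - int (Xi_a \<eta> m p (i - 1))) * Xi_b \<eta> m p i)"
proof -
  let ?l = "shift_seq k \<eta>" and ?m = "shift_seq k (fst (Xi \<eta> m p))"
  \<comment> \<open>Extends \<open>b\<close> by the convention \<open>b_s = 0\<close>, where the
    telescoping sum ends.\<close>
  define f where "f j = (if j < s then Xi_b \<eta> m p j else 0)" for j
  have len: "length (fst (Xi \<eta> m p)) = s" using length_fst_Xi[OF \<eta>] s by simp
  have tel: "(\<Sum>h=i+1..s. ?m !\<^sub>1 h - ?l !\<^sub>1 (h + 1)) = f i" if "1 \<le> i" "i \<le> s" for i
  proof -
    have "(\<Sum>h=i+1..s. ?m !\<^sub>1 h - ?l !\<^sub>1 (h + 1)) = - (\<Sum>h=Suc i..s. f h - f (h - 1))"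
      unfolding sum_negf[symmetric]
    proof (intro sum.cong refl)
      fix h assume "h \<in> {Suc i..s}"
      then show "?m !\<^sub>1 h - ?l !\<^sub>1 (h + 1) = - (f h - f (h - 1))"
        using Xi_diff_right[OF \<eta> s, of h k m p] that by (auto simp: f_def)
    qed simp
    also have "\<dots> = f i - f s" using that sum_telescope''[of i s f] by simp
    also have "\<dots> = f i" by (simp add: f_def)
    finally show ?thesis .
  qed
  have "row_area ?l ?m = (\<Sum>i=1..s. (?l !\<^sub>1 i - ?m !\<^sub>1 i) * f i)"
    unfolding row_area_def length_shift_seq len sum_distrib_left[symmetric]
    by (intro sum.cong) (use tel in auto)
  also have "\<dots> = (\<Sum>i=1..s-1. (?l !\<^sub>1 i - ?m !\<^sub>1 i) * f i)"
    using s by (cases s) (auto simp: f_def)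
  also have "\<dots> = (\<Sum>i=1..s-1. (int (Xi_a \<eta> m p i) - int (Xi_a \<eta> m p (i - 1))) * Xi_b \<eta> m p i)"
    using s Xi_diff_left[OF \<eta> s, of _ k m p] by (intro sum.cong) (auto simp: f_def)
  finally show ?thesis .
qed

text \<open>Block j consists of the rows from \<open>a_{j-1}\<close> up to \<open>a_j\<close>.
  Cutting \<open>b_j\<close> off each of them leaves the j-th piece, and \<open>row_area_Xi\<close>
  counts what is cut off. The rows from \<open>a_{s-1}\<close> on form the last piece uncut.\<close>

lemma psize_Xi:
  assumes p: "is_partition p" and \<eta>: "length \<eta> = s + 1" "s \<ge> 1"
    and mono: "non_increasing (shift_seq k \<eta>)"
  shows "row_area (shift_seq k \<eta>) (shift_seq k (fst (Xi \<eta> m p)))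
      + int (\<Sum>i=1..s. psize (snd (Xi \<eta> m p) !\<^sub>1 i)) = int (psize p)"
proof (cases "s = 1")
  case True
  then show ?thesis using \<eta> by (simp add: Xi_one row_area_def)
next
  case False
  then have s: "s \<ge> 2" using \<eta> by simp
  let ?a = "Xi_a \<eta> m p" and ?b = "Xi_b \<eta> m p"
  have block: "int (psize (Xi_part \<eta> m p j)) + (int (?a j) - int (?a (j - 1))) * ?b j
      = int (\<Sum>n=?a (j-1)..<?a j. p n)" if j: "1 \<le> j" "j < s" for j
  proof -
    have le: "?a (j - 1) \<le> ?a j" using Xi_a_le_Xi_a[OF p \<eta>(1) s mono] j by simp
    have b: "int (nat (?b j)) = ?b j" using Xi_b_nonneg[OF p j(1), of \<eta> m] by simp
    have "psize (Xi_part \<eta> m p j) = (\<Sum>n<?a j - ?a (j-1). Xi_part \<eta> m p j n)"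
      by (rule psize_eq_sum) (use j in \<open>auto simp: Xi_part_less[OF \<eta>(1)]\<close>)
    also have "\<dots> = (\<Sum>n<?a j - ?a (j-1). p (n + ?a (j-1)) - nat (?b j))"
      by (intro sum.cong) (use j in \<open>auto simp: Xi_part_less[OF \<eta>(1)]\<close>)
    finally have "psize (Xi_part \<eta> m p j) + (?a j - ?a (j-1)) * nat (?b j)
        = (\<Sum>n<?a j - ?a (j-1). (p (n + ?a (j-1)) - nat (?b j)) + nat (?b j))"
      by (simp add: sum.distrib)
    also have "\<dots> = (\<Sum>n<?a j - ?a (j-1). p (n + ?a (j-1)))"
      \<comment> \<open>Every row of the block has length at least \<open>b_j\<close>, so adding
        \<open>b_j\<close> undoes the natural-number subtraction.\<close>
      using Xi_b_le[OF p j(1), of _ \<eta> m] by (intro sum.cong) (auto simp: nat_le_iff)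
    also have "\<dots> = (\<Sum>n=?a (j-1)..<?a j. p n)"
      using le sum.shift_bounds_nat_ivl[of p 0 "?a (j-1)" "?a j - ?a (j-1)"]
      by (simp add: atLeast0LessThan)
    finally have "int (psize (Xi_part \<eta> m p j) + (?a j - ?a (j-1)) * nat (?b j))
        = int (\<Sum>n=?a (j-1)..<?a j. p n)"
      by (rule arg_cong)
    then show ?thesis using le b by (simp only: of_nat_add of_nat_mult of_nat_diff)
  qed
  have init: "(\<Sum>i=1..j. int (psize (Xi_part \<eta> m p i)) + (int (?a i) - int (?a (i - 1))) * ?b i)
      = int (\<Sum>n<?a j. p n)" if "j < s" for j
    using that
  proof (induction j)
    case (Suc j)
    have "?a j \<le> ?a (Suc j)" using Xi_a_le_Xi_a[OF p \<eta>(1) s mono] Suc.prems by simp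
    then have "(\<Sum>n<?a (Suc j). p n) = (\<Sum>n<?a j. p n) + (\<Sum>n=?a j..<?a (Suc j). p n)"
      by (simp add: lessThan_atLeast0 sum.atLeastLessThan_concat)
    then show ?case using Suc block[of "Suc j"] by simp
  qed simp
  obtain M where M: "\<And>n. n \<ge> M \<Longrightarrow> p n = 0"
    using p unfolding is_partition_def by blast
  have "psize (Xi_part \<eta> m p s) = (\<Sum>n<M. p (n + ?a (s-1)))"
    by (subst psize_eq_sum[of M]) (auto simp: Xi_part_last[OF \<eta>(1)] intro: M)
  moreover have "psize p = (\<Sum>n<M + ?a (s-1). p n)"
    by (rule psize_eq_sum) (auto intro: M)
  moreover have "\<dots> = (\<Sum>n<?a (s-1). p n) + (\<Sum>n<M. p (n + ?a (s-1)))"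
    using sum.shift_bounds_nat_ivl[of p 0 "?a (s-1)" M]
      sum.atLeastLessThan_concat[of 0 "?a (s-1)" "M + ?a (s-1)" p]
    by (simp add: lessThan_atLeast0)
  ultimately have total: "int (psize p) = int (\<Sum>n<?a (s-1). p n) + int (psize (Xi_part \<eta> m p s))"
    by simp
  have "(\<Sum>i=1..s. psize (snd (Xi \<eta> m p) !\<^sub>1 i)) = (\<Sum>i=1..s. psize (Xi_part \<eta> m p i))"
    using snd_Xi_nth1[OF \<eta>(1) s, of _ m p] by (intro sum.cong) auto
  also have "\<dots> = (\<Sum>i=1..s-1. psize (Xi_part \<eta> m p i)) + psize (Xi_part \<eta> m p s)"
    using s by (cases s) auto
  finally show ?thesis
    unfolding row_area_Xi[OF \<eta>(1) s] total using init[of "s - 1"] s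
    by (simp add: sum.distrib)
qed

section \<open>Recovering the partition from the new row and the pieces\<close>

lemma Xi_inj:
  assumes \<eta>: "length \<eta> = s + 1" "s \<ge> 1" and p: "is_partition p" and p': "is_partition p'"
    and eq: "Xi \<eta> m p = Xi \<eta> m p'"
  shows "p = p'"
proof (cases "s = 1")
  case True
  then show ?thesis using \<eta> eq by (simp add: Xi_one)
next
  case False
  then have s: "s \<ge> 2" using \<eta> by simp
  \<comment> \<open>The prefix sums of the new row give \<open>a_j\<close>, and then
    \<open>b_j = a_j - c_j\<close>.\<close>
  have a: "Xi_a \<eta> m p j = Xi_a \<eta> m p' j" if "j < s" for j
    using sum_fst_Xi[OF \<eta>(1) s that, of m p] sum_fst_Xi[OF \<eta>(1) s that, of m p'] eq by simp
  have b: "Xi_b \<eta> m p j = Xi_b \<eta> m p' j" if "j < s" for j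
    using a[OF that] by (simp add: Xi_b_def)
  have q: "Xi_part \<eta> m p j n = Xi_part \<eta> m p' j n" if "1 \<le> j" "j \<le> s" for j n
    using snd_Xi_nth1[OF \<eta>(1) s that] eq by metis
  show ?thesis
  proof
    fix n
    show "p n = p' n"
    proof (cases "n < Xi_a \<eta> m p (s - 1)")
      case True
      \<comment> \<open>The block containing row n: minimality of j yields
        \<open>a_{j-1} \<le> n\<close>.\<close>
      define j where "j = (LEAST j. n < Xi_a \<eta> m p j)"
      have j: "n < Xi_a \<eta> m p j" and js: "j \<le> s - 1"
        unfolding j_def using True by (rule LeastI, intro Least_le)
      have j1: "1 \<le> j" using j by (cases j) auto
      then have lo: "Xi_a \<eta> m p (j - 1) \<le> n"
        using not_less_Least[of "j - 1" "\<lambda>j. n < Xi_a \<eta> m p j"] unfolding j_def[symmetric] by simp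
      have js': "j < s" "j - 1 < s" using js s by auto
      have "p n - nat (Xi_b \<eta> m p j) = p' n - nat (Xi_b \<eta> m p j)"
        using q[of j "n - Xi_a \<eta> m p (j - 1)"] j1 js' lo j
        unfolding Xi_part_less[OF \<eta>(1) js'(1)] a[OF js'(1), symmetric] a[OF js'(2), symmetric]
          b[OF js'(1), symmetric] by simp
      \<comment> \<open>Hence both subtractions in the preceding equation are exact and
        \<open>b_j\<close> cancels.\<close>
      moreover have "Xi_b \<eta> m p j \<le> int (p n)" "Xi_b \<eta> m p j \<le> int (p' n)"
        using Xi_b_le[OF p j1 j] Xi_b_le[OF p' j1, of n \<eta> m] j a[OF js'(1)] b[OF js'(1)] by auto
      ultimately show ?thesis by linarith
    next
      case False
      then show ?thesis
        using q[of s "n - Xi_a \<eta> m p (s - 1)"] s a[of "s - 1"]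
        by (simp add: Xi_part_last[OF \<eta>(1)])
    qed
  qed
qed

text \<open>The given side lengths must be the steps between the corners, so the corners are forced:
  \<open>A j\<close> adds up the first j values of \<open>D\<close>, and \<open>B j\<close> the
  values of \<open>E\<close> after j. A row of block j is a part of the j-th piece raised by
  \<open>B j\<close>. \<open>Xi_a_eqI\<close> confirms that the glued partition has these
  corners.\<close>

lemma Xi_surj:
  assumes \<eta>: "length \<eta> = s + 1" "s \<ge> 1" and \<eta>': "length \<eta>' = s" and qs: "length qs = s"
    and m: "sum_list \<eta> - sum_list \<eta>' = m"
    and i: "interlace (shift_seq k \<eta>) (shift_seq k \<eta>')"
    and part: "\<And>i. 1 \<le> i \<Longrightarrow> i \<le> s \<Longrightarrow> is_partition (qs !\<^sub>1 i)"
    and fits: "\<And>i. 1 \<le> i \<Longrightarrow> i \<le> s \<Longrightarrow> fits_into (qs !\<^sub>1 i)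
      (shift_seq k \<eta> !\<^sub>1 i - shift_seq k \<eta>' !\<^sub>1 i) (shift_seq k \<eta>' !\<^sub>1 i - shift_seq k \<eta> !\<^sub>1 (i + 1))"
  obtains p where "is_partition p" and "Xi \<eta> m p = (\<eta>', qs)"
proof (cases "s = 1")
  case True
  then obtain x y z q where eqs: "\<eta> = [x, y]" "\<eta>' = [z]" "qs = [q]"
    using \<eta> \<eta>' qs by (auto simp: length_Suc_conv numeral_2_eq_2)
  then have "is_partition q" using part[of 1] True by simp
  then show ?thesis using that[of q] m eqs by (simp add: Xi_one)
next
  case False
  then have s: "s \<ge> 2" using \<eta> by simp
  let ?q = "\<lambda>i. qs !\<^sub>1 i"
  define D where "D i = shift_seq k \<eta> !\<^sub>1 i - shift_seq k \<eta>' !\<^sub>1 i" for i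
  define E where "E i = shift_seq k \<eta>' !\<^sub>1 i - shift_seq k \<eta> !\<^sub>1 (i + 1)" for i
  have D0: "D i \<ge> 0" and E0: "E i \<ge> 0" if "1 \<le> i" "i \<le> s" for i
    using i that \<eta>' unfolding interlace_def D_def E_def by auto
  have q_fit: "?q i (nat (D i)) = 0" "?q i 0 = 0 \<or> int (?q i 0) \<le> E i" if "1 \<le> i" "i \<le> s" for i
    using fits[OF that, folded D_def E_def] unfolding fits_into_iff[OF part[OF that]] by auto
  define A where "A j = (\<Sum>i=1..j. nat (D i))" for j
  define B where "B j = (\<Sum>i=j+1..s. nat (E i))" for j
  have A_Suc: "A j = A (j - 1) + nat (D j)" if "1 \<le> j" for j
    using that unfolding A_def by (cases j) auto
  have B_Suc: "B (j - 1) = B j + nat (E j)" if "1 \<le> j" "j \<le> s" for j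
    using that unfolding B_def by (cases j) (auto simp: sum.atLeast_Suc_atMost)
  have A_mono: "A i \<le> A j" if "i \<le> j" for i j
    unfolding A_def using that by (intro sum_mono2) auto
  have B_mono: "B j \<le> B i" if "i \<le> j" for i j
    unfolding B_def using that by (intro sum_mono2) auto
  have q_le: "?q j 0 \<le> nat (E j)" if "1 \<le> j" "j \<le> s" for j
    using q_fit(2)[OF that] by linarith
  \<comment> \<open>Raised by \<open>B j\<close>, the piece stays within \<open>B (j - 1)\<close>, a
    lower bound for the preceding block; so gluing keeps the rows non-increasing.\<close>
  have q_B: "?q j n + B j \<le> B (j - 1)" if "1 \<le> j" "j \<le> s" for j n
    using is_partition_antimono[OF part[OF that], of 0 n] q_le[OF that] B_Suc[OF that] by simp
  \<comment> \<open>The candidate corner lies on the diagonal of \<open>c_j\<close>; this is where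
    the condition on the row sums enters. As \<open>1 \<le> j < s\<close>, neither
    \<open>D s\<close> nor \<open>E 1\<close>, the sides that carry k, occurs.\<close>
  have AB: "int (A j) - int (B j) = m - \<eta> !\<^sub>1 (j + 1)" if j: "1 \<le> j" "j < s" for j
  proof -
    have "int (A j) = (\<Sum>i=1..j. \<eta> !\<^sub>1 i - \<eta>' !\<^sub>1 i)"
      unfolding A_def of_nat_sum
    proof (intro sum.cong refl)
      fix i assume "i \<in> {1..j}"
      then show "int (nat (D i)) = \<eta> !\<^sub>1 i - \<eta>' !\<^sub>1 i"
        using D0[of i] j shift_seq_diff_left[OF \<eta>(1) \<eta>', of i k] by (simp add: D_def)
    qed
    moreover have "int (B j) = (\<Sum>i=j+1..s. \<eta>' !\<^sub>1 i - \<eta> !\<^sub>1 (i + 1))"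
      unfolding B_def of_nat_sum
    proof (intro sum.cong refl)
      fix i assume "i \<in> {j + 1..s}"
      then show "int (nat (E i)) = \<eta>' !\<^sub>1 i - \<eta> !\<^sub>1 (i + 1)"
        using E0[of i] j shift_seq_diff_right[OF \<eta>(1) \<eta>', of i k] by (simp add: E_def)
    qed
    moreover have "(\<Sum>i=j+1..s. \<eta> !\<^sub>1 (i + 1)) = (\<Sum>i=j+2..s+1. \<eta> !\<^sub>1 i)"
      using sum.shift_bounds_cl_Suc_ivl[of "\<lambda>i. \<eta> !\<^sub>1 i" "j + 1" s] by simp
    moreover have "sum_list \<eta> = (\<Sum>i=1..j. \<eta> !\<^sub>1 i) + \<eta> !\<^sub>1 (j + 1) + (\<Sum>i=j+2..s+1. \<eta> !\<^sub>1 i)"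
      unfolding sum_list_nth1 \<eta>(1)
      using sum.ub_add_nat[of 1 j "\<lambda>i. \<eta> !\<^sub>1 i" "s + 1 - j"] j
        sum.atLeast_Suc_atMost[of "j + 1" "s + 1" "\<lambda>i. \<eta> !\<^sub>1 i"] by simp
    moreover have "sum_list \<eta>' = (\<Sum>i=1..j. \<eta>' !\<^sub>1 i) + (\<Sum>i=j+1..s. \<eta>' !\<^sub>1 i)"
      unfolding sum_list_nth1 \<eta>'
      using sum.ub_add_nat[of 1 j "\<lambda>i. \<eta>' !\<^sub>1 i" "s - j"] j by simp
    ultimately show ?thesis using m by (simp add: sum_subtractf)
  qed
  define p where "p n = (if n < A (s - 1)
      then let j = LEAST j. n < A j in ?q j (n - A (j - 1)) + B j
      else ?q s (n - A (s - 1)))" for n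
  have p_less: "p n = ?q j (n - A (j - 1)) + B j" if "A (j - 1) \<le> n" "n < A j" "j < s" for j n
  proof -
    have "(LEAST j. n < A j) = j"
    proof (rule Least_equality)
      show "n < A j" by (rule that(2))
    next
      fix i assume "n < A i"
      then show "j \<le> i" using A_mono[of i "j - 1"] that(1) by fastforce
    qed
    moreover have "A j \<le> A (s - 1)" by (rule A_mono) (use that in linarith)
    then have "n < A (s - 1)" using that by simp
    ultimately show ?thesis by (simp add: p_def)
  qed
  have p_last: "p n = ?q s (n - A (s - 1))" if "A (s - 1) \<le> n" for n
    using that by (simp add: p_def)
  have block: "(\<exists>j. 1 \<le> j \<and> j < s \<and> A (j - 1) \<le> n \<and> n < A j) \<or> A (s - 1) \<le> n" for n
  proof (cases "n < A (s - 1)")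
    case True
    define j where "j = (LEAST j. n < A j)"
    have j: "n < A j" and js: "j \<le> s - 1"
      unfolding j_def using True by (rule LeastI, intro Least_le)
    have j1: "1 \<le> j" using j by (cases j) (auto simp: A_def)
    then have "A (j - 1) \<le> n"
      using not_less_Least[of "j - 1" "\<lambda>j. n < A j"] unfolding j_def[symmetric] by simp
    then show ?thesis using j js j1 s by (intro disjI1 exI[of _ j]) auto
  qed simp
  have B_s: "B s = 0" by (simp add: B_def)
  \<comment> \<open>With \<open>AB\<close>, this and \<open>p_ge\<close> become the two hypotheses
    of \<open>Xi_a_eqI\<close> at \<open>A j\<close>.\<close>
  have p_le: "p n \<le> B j" if "A j \<le> n" "j < s" for j n
    using block[of n]
  proof
    assume "\<exists>i. 1 \<le> i \<and> i < s \<and> A (i - 1) \<le> n \<and> n < A i"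
    then obtain i where i: "1 \<le> i" "i < s" "A (i - 1) \<le> n" "n < A i" by blast
    have "j \<le> i - 1"
    proof (rule ccontr)
      assume "\<not> j \<le> i - 1"
      then have "A i \<le> A j" by (intro A_mono) linarith
      then show False using i that by simp
    qed
    then show ?thesis using p_less[of i n] q_B[of i] B_mono[of j "i - 1"] i by (metis less_imp_le order_trans)
  next
    assume "A (s - 1) \<le> n"
    moreover have "B (s - 1) \<le> B j" by (rule B_mono) (use that in linarith)
    ultimately show ?thesis using p_last q_B[of s "n - A (s - 1)"] B_s s by simp
  qed
  have p_ge: "p n \<ge> B j" if "n < A j" "j < s" for j n
  proof -
    have "A j \<le> A (s - 1)" by (rule A_mono) (use that in linarith)
    then have "\<not> A (s - 1) \<le> n" using that by simp
    then obtain i where i: "1 \<le> i" "i < s" "A (i - 1) \<le> n" "n < A i"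
      using block[of n] by blast
    have "i \<le> j"
    proof (rule ccontr)
      assume "\<not> i \<le> j"
      then have "A j \<le> A (i - 1)" by (intro A_mono) linarith
      then show False using i that by simp
    qed
    then show ?thesis using p_less[OF i(3,4,2)] B_mono[of i j] by simp
  qed
  have "is_partition p"
  proof -
    obtain M where M: "\<And>n. n \<ge> M \<Longrightarrow> ?q s n = 0"
      using part[OF \<eta>(2) order_refl] unfolding is_partition_def by blast
    show ?thesis
    proof (rule is_partitionI[where N = "M + A (s - 1)"])
      fix n n' :: nat assume n: "n \<le> n'"
      show "p n' \<le> p n"
        using block[of n]
      proof
        assume "\<exists>i. 1 \<le> i \<and> i < s \<and> A (i - 1) \<le> n \<and> n < A i"
        then obtain i where i: "1 \<le> i" "i < s" "A (i - 1) \<le> n" "n < A i" by blast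
        show ?thesis
        proof (cases "n' < A i")
          case True
          have "?q i (n' - A (i - 1)) \<le> ?q i (n - A (i - 1))"
            using i n by (intro is_partition_antimono[OF part[of i]]) auto
          then show ?thesis
            using p_less[OF i(3,4,2)] p_less[of i n'] i n True by simp
        next
          case False
          then have "p n' \<le> B i" "B i \<le> p n" using p_le p_ge i by auto
          then show ?thesis by simp
        qed
      next
        assume "A (s - 1) \<le> n"
        moreover have "?q s (n' - A (s - 1)) \<le> ?q s (n - A (s - 1))"
          using s n by (intro is_partition_antimono[OF part[of s]]) auto
        ultimately show ?thesis using p_last[of n] p_last[of n'] n by simp
      qed
    qed (use p_last M in simp)
  qed
  moreover have "Xi \<eta> m p = (\<eta>', qs)"
  proof -
    have a: "Xi_a \<eta> m p j = A j" if "j < s" for j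
    proof (cases "j = 0")
      case False
      then show ?thesis
        using p_ge[of "A j - 1" j] p_le[of j "A j"] AB[of j] that
        by (cases "A j = 0"; intro Xi_a_eqI[OF \<open>is_partition p\<close>]) (auto simp: Xi_c_def)
    qed (simp add: A_def)
    have b: "Xi_b \<eta> m p j = int (B j)" if "1 \<le> j" "j < s" for j
      using a[OF that(2)] AB[OF that] by (simp add: Xi_b_def Xi_c_def)
    have "Xi_seq \<eta> m p j = \<eta>' !\<^sub>1 j" if j: "1 \<le> j" "j \<le> s" for j
    proof (cases "j = s")
      case True
      have "B (s - 1) = nat (E s)" using B_Suc[of s] B_s s by simp
      then have "int (B (s - 1)) = \<eta>' !\<^sub>1 s - \<eta> !\<^sub>1 (s + 1)"
        using E0[of s] s shift_seq_diff_right[OF \<eta>(1) \<eta>', of s k] by (simp add: E_def)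
      then show ?thesis
        unfolding True Xi_seq_last[OF \<eta>(1)] using b[of "s - 1"] s by simp
    next
      case False
      then have "D j = \<eta> !\<^sub>1 j - \<eta>' !\<^sub>1 j"
        using shift_seq_diff_left[OF \<eta>(1) \<eta>', of j k] j by (simp add: D_def)
      moreover have "int (A j) - int (A (j - 1)) = D j"
        using A_Suc[OF j(1)] D0[OF j] by simp
      ultimately show ?thesis
        using Xi_seq_less[OF \<eta>(1), of j m p] False j a[of j] a[of "j - 1"] by simp
    qed
    moreover have "Xi_part \<eta> m p j = ?q j" if j: "1 \<le> j" "j \<le> s" for j
    proof
      fix n
      show "Xi_part \<eta> m p j n = ?q j n"
      proof (cases "j = s")
        case True
        then show ?thesis
          using Xi_part_last[OF \<eta>(1), of m p n] a[of "s - 1"] s p_last by simp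
      next
        case False
        then have js: "j < s" "j - 1 < s" using j by auto
        show ?thesis
        proof (cases "n + A (j - 1) < A j")
          case True
          then show ?thesis
            using p_less[of j "n + A (j - 1)"] js unfolding Xi_part_less[OF \<eta>(1) js(1)] a[OF js(1)] a[OF js(2)] b[OF j(1) js(1)]
            by simp
        next
          case False
          \<comment> \<open>Beyond the height of block j the left side is 0 by definition, the right
            side because the piece has at most \<open>D j\<close> parts.\<close>
          then have "nat (D j) \<le> n" using A_Suc[OF j(1)] by simp
          then have "?q j n = 0"
            using is_partition_antimono[OF part[OF j], of "nat (D j)" n] q_fit(1)[OF j] by simp
          then show ?thesis
            using False unfolding Xi_part_less[OF \<eta>(1) js(1)] a[OF js(1)] a[OF js(2)] by simp
        qed
      qed
    qed
    ultimately have "Xi_seq \<eta> m p (Suc i) = \<eta>' ! i" "Xi_part \<eta> m p (Suc i) = qs ! i" if "i < s" for i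
      using that by (metis One_nat_def Suc_leI diff_Suc_1 le_add1 plus_1_eq_Suc)+
    then show ?thesis
      using False \<eta> \<eta>' qs by (auto simp: Xi_def intro!: nth_equalityI simp del: upt_Suc)
  qed
  ultimately show ?thesis by (rule that)
qed

subsection \<open>Majorization up to a defect\<close>

text \<open>Sums over arbitrary index sets of \<open>y\<close> replace sums of its largest entries,
  so no sorting is involved and an entry can be split off the end of \<open>y\<close>. Prefixes of
  \<open>x\<close> are taken in the given order, as \<open>sum_fst_Xi\<close> computes them.\<close>

definition majorizes_upto :: "int \<Rightarrow> int list \<Rightarrow> int list \<Rightarrow> bool" where
  "majorizes_upto e x y \<longleftrightarrow> length x = length y \<and> sum_list x = sum_list y \<and>
     (\<forall>S\<subseteq>{..<length y}. (\<Sum>i\<in>S. y ! i) \<le> sum_list (take (card S) x) + e)"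

text \<open>Induction along the list: remove \<open>y\<close> from \<open>N\<close> if it occurs
  there, otherwise any element, which is at most \<open>y\<close>. Either way the rest is contained
  in \<open>ys\<close>. Multisets account for repeated entries.\<close>

lemma sum_mset_le_sum_list_take:
  assumes "non_increasing ys" and "N \<subseteq># mset ys"
  shows "sum_mset N \<le> sum_list (take (size N) ys)"
  using assms
proof (induction ys arbitrary: N)
  case (Cons y ys)
  show ?case
  proof (cases "N = {#}")
    case False
    then obtain x M where N: "N = add_mset x M" and x: "y \<in># N \<longrightarrow> x = y"
      by (metis multiset_cases insert_DiffM)
    have "x \<in> set (y # ys)" using Cons.prems(2) N
      by (metis mset_subset_eqD set_mset_mset union_single_eq_member)
    then have "x \<le> y" using Cons.prems(1) by auto
    moreover have "M \<subseteq># mset ys"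
    proof (cases "x = y")
      case True
      then show ?thesis using Cons.prems(2) N by simp
    next
      case False
      then have "y \<notin># N" using x by auto
      then have "N \<subseteq># mset ys"
        using Cons.prems(2) by (simp add: subset_eq_diff_conv diff_single_trivial flip: subset_eq_diff_conv)
          (metis add_mset_remove_trivial diff_single_trivial subset_eq_diff_conv mset_subset_eq_add_right
            add_mset_add_single)
      then show ?thesis using N by (metis mset_subset_eq_insertD subset_mset.less_imp_le)
    qed
    with Cons have "sum_mset M \<le> sum_list (take (size M) ys)" by simp
    ultimately show ?thesis using N by simp
  qed simp
qed simp

text \<open>The induction over the rows starts here, with defect 0. The entries of \<open>y\<close>
  at an index set form a submultiset of its sorted list, so their sum is at most that of equally
  many largest entries; for \<open>x\<close> sorting is reversal.\<close>

lemma majorizes_imp_majorizes_upto: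
  assumes maj: "majorizes x y" and x: "non_increasing x"
  shows "majorizes_upto 0 x y"
proof -
  have len: "length x = length y" using maj by (simp add: majorizes_def)
  have "sort x = rev x"
    by (rule properties_for_sort) (use x in \<open>auto simp: sorted_wrt_rev\<close>)
  then have lx: "sum_largest n x = sum_list (take n x)" for n by (simp add: sum_largest_def)
  have desc: "non_increasing (rev (sort y))" by (simp add: sorted_wrt_rev)
  have sub: "(\<Sum>i\<in>S. y ! i) \<le> sum_largest (card S) y" if "S \<subseteq> {..<length y}" for S
  proof -
    have "mset y = image_mset ((!) y) (mset_set {..<length y})"
      by (metis lessThan_atLeast0 map_nth mset_map mset_upt)
    then have "image_mset ((!) y) (mset_set S) \<subseteq># mset (rev (sort y))"
      using that by (auto intro!: image_mset_subseteq_mono subset_imp_msubset_mset_set)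
    from sum_mset_le_sum_list_take[OF desc this] show ?thesis
      by (simp add: sum_largest_def sum_unfold_sum_mset)
  qed
  have "(\<Sum>i\<in>S. y ! i) \<le> sum_list (take (card S) x)" if S: "S \<subseteq> {..<length y}" for S
  proof (cases "card S = 0")
    case True
    then have "S = {}" using S finite_subset by fastforce
    then show ?thesis by simp
  next
    case False
    then have "card S \<in> {1..length x}" using S len card_mono[OF finite_lessThan S] by simp
    then show ?thesis using sub[OF S] maj lx unfolding majorizes_def by fastforce
  qed
  moreover have "sum_list x = sum_list y"
    using maj lx[of "length x"] len unfolding majorizes_def
    by (simp add: sum_largest_def flip: sum_mset_sum_list)
  ultimately show ?thesis using len by (simp add: majorizes_upto_def)
qed

lemma sum_list_take_nth1: "t \<le> length x \<Longrightarrow> sum_list (take t x) = (\<Sum>i=1..t. x !\<^sub>1 i)" for x :: "int list"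
  by (auto simp: sum_list_nth1 intro!: sum.cong)

text \<open>For S of size t, test the hypothesis on S and on S with the index of \<open>m\<close>
  added: the sum over S is at most the first t entries of \<open>\<eta>\<close> plus e - max(0,
  c_t). The step lowers this prefix by \<open>a_t\<close>, which is at most |p| + max(0, c_t), so
  |p| bounds the increase of the defect.\<close>

lemma majorizes_upto_Xi:
  assumes maj: "majorizes_upto e \<eta> (\<mu> @ [m])" and e: "e \<ge> 0"
    and \<eta>: "length \<eta> = s + 1" "s \<ge> 1" and p: "is_partition p"
  shows "majorizes_upto (e + int (psize p)) (fst (Xi \<eta> m p)) \<mu>"
proof -
  let ?\<eta>' = "fst (Xi \<eta> m p)"
  have len: "length \<mu> = s" and len': "length ?\<eta>' = s"
    using maj \<eta> length_fst_Xi[OF \<eta>] by (auto simp: majorizes_upto_def)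
  have total: "sum_list ?\<eta>' = sum_list \<mu>"
    using maj sum_list_fst_Xi[OF \<eta>, of m p] by (simp add: majorizes_upto_def)
  have "(\<Sum>i\<in>S. \<mu> ! i) \<le> sum_list (take (card S) ?\<eta>') + (e + int (psize p))"
    if S: "S \<subseteq> {..<s}" for S
  proof -
    have fin: "finite S" using S finite_subset by blast
    have card: "card S \<le> s" using card_mono[OF finite_lessThan S] by simp
    \<comment> \<open>The corner \<open>a_t\<close> exists only for 1 \<le> t < s; for the full set
      the totals agree.\<close>
    consider "card S = 0" | "card S = s" | "1 \<le> card S" "card S < s" using card by linarith
    then show ?thesis
    proof cases
      case 1
      then show ?thesis using fin e by simp
    next
      case 2
      then have "S = {..<s}" using S by (simp add: card_subset_eq)
      then show ?thesis using total e len len' by (simp add: sum_list_sum_nth atLeast0LessThan)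
    next
      case 3
      let ?t = "card S"
      have s: "s \<ge> 2" using 3 by simp
      have bound: "(\<Sum>i\<in>T. (\<mu> @ [m]) ! i) \<le> (\<Sum>i=1..card T. \<eta> !\<^sub>1 i) + e" if "T \<subseteq> {..<s+1}" for T
      proof -
        have "card T \<le> length \<eta>" using card_mono[OF finite_lessThan that] \<eta> by simp
        from sum_list_take_nth1[OF this, symmetric] show ?thesis
          using maj that len unfolding majorizes_upto_def by simp
      qed
      have "(\<Sum>i\<in>S. (\<mu> @ [m]) ! i) = (\<Sum>i\<in>S. \<mu> ! i)"
        using S len by (intro sum.cong) (auto simp: nth_append)
      moreover have "s \<notin> S" using S by auto
      then have "(\<Sum>i\<in>insert s S. (\<mu> @ [m]) ! i) = m + (\<Sum>i\<in>S. (\<mu> @ [m]) ! i)"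
        "card (insert s S) = Suc ?t"
        using fin len by (simp_all add: nth_append)
      \<comment> \<open>Adding the index of \<open>m\<close> contributes \<open>m\<close> on the
        left and \<open>\<eta>_{t+1}\<close> on the right, which turns the first bound into the
        second.\<close>
      ultimately have "(\<Sum>i\<in>S. \<mu> ! i) \<le> (\<Sum>i=1..?t. \<eta> !\<^sub>1 i) + e"
        "(\<Sum>i\<in>S. \<mu> ! i) \<le> (\<Sum>i=1..?t. \<eta> !\<^sub>1 i) + e - Xi_c \<eta> m ?t"
        using bound[of S] bound[of "insert s S"] lessThan_Suc[of s] S
        by (auto simp: Xi_c_def subset_insertI2)
      moreover have "sum_list (take ?t ?\<eta>') = (\<Sum>i=1..?t. \<eta> !\<^sub>1 i) - int (Xi_a \<eta> m p ?t)"
        using sum_list_take_nth1[of ?t ?\<eta>'] sum_fst_Xi[OF \<eta>(1) s 3(2)] len' card by simp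
      ultimately show ?thesis using Xi_a_le[OF p 3(1), of \<eta> m] by linarith
    qed
  qed
  then show ?thesis using total len len' by (simp add: majorizes_upto_def)
qed

subsection \<open>Removing the last row of an array\<close>

lemma ball_atLeast1_Suc: "(\<forall>j\<in>{1..Suc n}. P j) \<longleftrightarrow> (\<forall>j\<in>{1..n}. P j) \<and> P (Suc n)"
  by (simp add: atLeastAtMostSuc_conv conj_commute)

lemma last_nth1: "length xs = Suc n \<Longrightarrow> xs !\<^sub>1 Suc n = last xs"
  by (cases xs rule: rev_cases) auto

lemma integral_GT_pattern_snoc:
  assumes L: "length L = Suc r"
  shows "integral_GT_pattern (Suc r) (L @ [la]) \<longleftrightarrow> integral_GT_pattern r L \<and>
    length la = r + 2 \<and> non_increasing la \<and> interlace la (last L)"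
proof -
  have "(\<forall>j\<in>{1..r+1}. length ((L @ [la]) !\<^sub>1 j) = j \<and> non_increasing ((L @ [la]) !\<^sub>1 j))
    \<longleftrightarrow> (\<forall>j\<in>{1..r+1}. length (L !\<^sub>1 j) = j \<and> non_increasing (L !\<^sub>1 j))"
    using L by (intro ball_cong) (auto simp: nth_append)
  moreover have "(\<forall>j\<in>{1..r}. interlace ((L @ [la]) !\<^sub>1 (j + 1)) ((L @ [la]) !\<^sub>1 j))
    \<longleftrightarrow> (\<forall>j\<in>{1..r}. interlace (L !\<^sub>1 (j + 1)) (L !\<^sub>1 j))"
    using L by (intro ball_cong) (auto simp: nth_append)
  ultimately show ?thesis
    using L last_nth1[OF L] unfolding integral_GT_pattern_def Suc_eq_plus1[symmetric] ball_atLeast1_Suc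
    by (auto simp: nth_append)
qed

lemma is_POP_snoc:
  assumes L: "length L = Suc r" and Q: "length Q = r"
  shows "is_POP (Suc r) (L @ [la], Q @ [qs]) \<longleftrightarrow> is_POP r (L, Q) \<and>
    length la = r + 2 \<and> non_increasing la \<and> interlace la (last L) \<and> length qs = Suc r \<and>
    (\<forall>i\<in>{1..Suc r}. is_partition (qs !\<^sub>1 i) \<and>
      fits_into (qs !\<^sub>1 i) (la !\<^sub>1 i - last L !\<^sub>1 i) (last L !\<^sub>1 i - la !\<^sub>1 (i + 1)))"
proof -
  let ?P = "\<lambda>L Q j. length (Q !\<^sub>1 j) = j \<and> (\<forall>i\<in>{1..j}. is_partition (Q !\<^sub>1 j !\<^sub>1 i) \<and>
         fits_into (Q !\<^sub>1 j !\<^sub>1 i) (L !\<^sub>1 (j + 1) !\<^sub>1 i - L !\<^sub>1 j !\<^sub>1 i)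
           (L !\<^sub>1 j !\<^sub>1 i - L !\<^sub>1 (j + 1) !\<^sub>1 (i + 1)))"
  have "(\<forall>j\<in>{1..r}. ?P (L @ [la]) (Q @ [qs]) j) \<longleftrightarrow> (\<forall>j\<in>{1..r}. ?P L Q j)"
    using L Q by (intro ball_cong) (auto simp: nth_append)
  moreover have "?P (L @ [la]) (Q @ [qs]) (Suc r) \<longleftrightarrow> length qs = Suc r \<and>
    (\<forall>i\<in>{1..Suc r}. is_partition (qs !\<^sub>1 i) \<and>
      fits_into (qs !\<^sub>1 i) (la !\<^sub>1 i - last L !\<^sub>1 i) (last L !\<^sub>1 i - la !\<^sub>1 (i + 1)))"
    using L Q last_nth1[OF L] by (auto simp: nth_append)
  ultimately show ?thesis
    using Q unfolding is_POP_def prod.case ball_atLeast1_Suc integral_GT_pattern_snoc[OF L] by auto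
qed

lemma weight_snoc:
  assumes L: "length L = Suc r"
  shows "weight (Suc r) (L @ [la]) = weight r L @ [sum_list la - sum_list (last L)]"
proof -
  have "map (\<lambda>j. row_sum (L @ [la]) j - row_sum (L @ [la]) (j - 1)) [1..<r + 2] = weight r L"
    unfolding weight_def using L by (intro map_cong) (auto simp: row_sum_def nth_append)
  then show ?thesis
    using L last_nth1[OF L] by (simp add: weight_def row_sum_def nth_append)
qed

lemma proper_area_snoc:
  assumes L: "length L = Suc r" and last: "length (last L) = Suc r"
  shows "proper_area (Suc r) (L @ [la]) = proper_area r L + row_area la (last L)"
\<comment> \<open>The outer sum of \<open>proper_area\<close> starts at 2; for a single-entry lower
  row \<open>row_area\<close> is an empty sum.\<close>
proof (cases "r = 0")
  case True
  then show ?thesis using last by (simp add: proper_area_def row_area_def)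
next
  case False
  have "(\<Sum>j=2..r. \<Sum>i=1..j. \<Sum>h=i+1..j. ((L @ [la]) !\<^sub>1 (j + 1) !\<^sub>1 i - (L @ [la]) !\<^sub>1 j !\<^sub>1 i)
      * ((L @ [la]) !\<^sub>1 j !\<^sub>1 h - (L @ [la]) !\<^sub>1 (j + 1) !\<^sub>1 (h + 1))) = proper_area r L"
    unfolding proper_area_def using L by (intro sum.cong) (auto simp: nth_append)
  then show ?thesis
    using False L last last_nth1[OF L] unfolding proper_area_def row_area_def last
    by (simp add: nth_append)
qed

lemma overlay_size_snoc:
  assumes "length Q = r"
  shows "overlay_size (Suc r) (Q @ [qs]) = overlay_size r Q + (\<Sum>i=1..Suc r. psize (qs !\<^sub>1 i))"
proof -
  have "(\<Sum>j=1..r. \<Sum>i=1..j. psize ((Q @ [qs]) !\<^sub>1 j !\<^sub>1 i)) = overlay_size r Q"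
    unfolding overlay_size_def using assms by (intro sum.cong) (auto simp: nth_append)
  then show ?thesis using assms by (simp add: overlay_size_def nth_append)
qed

text \<open>Steps j to 1 read only the first j partitions and the entries of \<open>\<mu>\<close> up
  to index j + 1.\<close>

lemma Phi_upto_append:
  "j \<le> length ps \<Longrightarrow> j < length \<mu> \<Longrightarrow> Phi_upto (\<mu> @ \<mu>') (ps @ ps') j \<eta> = Phi_upto \<mu> ps j \<eta>"
  by (induction j arbitrary: \<eta>) (simp_all add: nth_append split: prod.split)

lemma Phi_Nil [simp]: "Phi \<eta> \<mu> [] = ([\<eta>], [])"
  by (simp add: Phi_def)

text \<open>The first step consumes the last partition and the last entry of \<open>\<mu>\<close>,
  so this form suits induction on \<open>ps\<close> from the right.\<close>

lemma Phi_snoc: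
  assumes "length \<mu> = Suc (length ps)"
  shows "Phi \<eta> (\<mu> @ [m]) (ps @ [p]) =
    (fst (Phi (fst (Xi \<eta> m p)) \<mu> ps) @ [\<eta>], snd (Phi (fst (Xi \<eta> m p)) \<mu> ps) @ [snd (Xi \<eta> m p)])"
  using assms by (simp add: Phi_def nth_append Phi_upto_append split: prod.split)

lemma length_Phi_upto:
  "length (fst (Phi_upto \<mu> ps j \<eta>)) = Suc j \<and> length (snd (Phi_upto \<mu> ps j \<eta>)) = j
    \<and> last (fst (Phi_upto \<mu> ps j \<eta>)) = \<eta>"
  by (induction j arbitrary: \<eta>) (auto split: prod.split simp: prod_eq_iff)

lemma Phi_shape:
  shows length_fst_Phi: "length (fst (Phi \<eta> \<mu> ps)) = Suc (length ps)"
    and length_snd_Phi: "length (snd (Phi \<eta> \<mu> ps)) = length ps"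
    and last_fst_Phi: "last (fst (Phi \<eta> \<mu> ps)) = \<eta>"
  using length_Phi_upto[of \<mu> ps "length ps" \<eta>] by (auto simp: Phi_def)

lemma shift_array_eq: "shift_array k P = (map (shift_seq k) (fst P), snd P)"
  by (simp add: shift_array_def case_prod_beta)

lemma inj_shift_array: "shift_array k P = shift_array k P' \<Longrightarrow> P = P'"
  unfolding shift_array_eq prod_eq_iff fst_conv snd_conv
  using map_injective[OF _ injI, of "shift_seq k" "fst P" "fst P'"] inj_shift_seq by blast

subsection \<open>The map Phi\<close>

text \<open>The remaining array ends in the row produced by the first step, and the last overlay
  entry holds its pieces, so the output of \<open>Xi\<close> can be read off. \<open>Xi_inj\<close>
  gives the last partition, induction the others.\<close>

lemma Phi_inj:
  assumes "length \<eta> = Suc (length ps)" and "length \<mu> = Suc (length ps)" and "length ps' = length ps"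
    and "\<forall>p\<in>set ps. is_partition p" and "\<forall>p\<in>set ps'. is_partition p"
    and "Phi \<eta> \<mu> ps = Phi \<eta> \<mu> ps'"
  shows "ps = ps'"
  using assms
proof (induction ps arbitrary: \<eta> \<mu> ps' rule: rev_induct)
  case (snoc p ps)
  obtain \<nu> m where \<mu>: "\<mu> = \<nu> @ [m]" "length \<nu> = Suc (length ps)"
    using snoc.prems(2) by (cases \<mu> rule: rev_cases) auto
  obtain qs q where ps': "ps' = qs @ [q]" "length qs = length ps"
    using snoc.prems(3) by (cases ps' rule: rev_cases) auto
  have eq: "Phi (fst (Xi \<eta> m p)) \<nu> ps = Phi (fst (Xi \<eta> m q)) \<nu> qs" "snd (Xi \<eta> m p) = snd (Xi \<eta> m q)"
    using snoc.prems(6) \<mu>(2) ps'(2) unfolding \<mu>(1) ps'(1) by (auto simp: Phi_snoc prod_eq_iff)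
  have "fst (Xi \<eta> m p) = fst (Xi \<eta> m q)"
    using arg_cong[OF eq(1), of "\<lambda>P. last (fst P)"] by (simp add: last_fst_Phi)
  then have "Xi \<eta> m p = Xi \<eta> m q" using eq(2) by (simp add: prod_eq_iff)
  then have "p = q"
    using Xi_inj[of \<eta> "Suc (length ps)" p q m] snoc.prems by (simp add: ps')
  moreover have "ps = qs"
  proof (rule snoc.IH)
    show "Phi (fst (Xi \<eta> m p)) \<nu> ps = Phi (fst (Xi \<eta> m p)) \<nu> qs"
      using eq(1) \<open>p = q\<close> by simp
  qed (use snoc.prems(1,4,5) \<mu>(2) ps' length_fst_Xi[of \<eta> "Suc (length ps)"] in auto)
  ultimately show ?case by (simp add: ps')
qed simp

text \<open>The invariant is that the defect \<open>e\<close> plus the size of the partitions still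
  to be used is at most k; a step moves |p| from the second summand to the first.\<close>

lemma Phi_is_POP:
  assumes "length \<eta> = Suc (length ps)" and "\<forall>p\<in>set ps. is_partition p"
    and "non_increasing (shift_seq k \<eta>)" and "majorizes_upto e \<eta> \<mu>" and "e \<ge> 0"
    and "e + int (sum_list (map psize ps)) \<le> k"
  shows "is_POP (length ps) (map (shift_seq k) (fst (Phi \<eta> \<mu> ps)), snd (Phi \<eta> \<mu> ps)) \<and>
    weight (length ps) (map (shift_seq k) (fst (Phi \<eta> \<mu> ps))) = map (\<lambda>m. m + k) \<mu> \<and>
    proper_area (length ps) (map (shift_seq k) (fst (Phi \<eta> \<mu> ps)))
      + int (overlay_size (length ps) (snd (Phi \<eta> \<mu> ps))) = int (sum_list (map psize ps))"
  using assms
proof (induction ps arbitrary: \<eta> \<mu> e rule: rev_induct)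
  case Nil
  then have "length \<eta> = Suc 0" "length \<mu> = Suc 0" by (auto simp: majorizes_upto_def)
  then obtain x y where eqs: "\<eta> = [x]" "\<mu> = [y]"
    unfolding length_Suc_conv by auto
  moreover have "x = y" using Nil eqs by (simp add: majorizes_upto_def)
  ultimately show ?case
    by (simp add: is_POP_def integral_GT_pattern_def weight_def row_sum_def shift_seq_def
        proper_area_def overlay_size_def)
next
  case (snoc p ps)
  let ?s = "Suc (length ps)"
  have \<eta>: "length \<eta> = ?s + 1" "?s \<ge> 1" and p: "is_partition p"
    using snoc.prems(1,2) by simp_all
  have "length \<mu> = ?s + 1" using snoc.prems by (simp add: majorizes_upto_def)
  then obtain \<nu> m where \<mu>: "\<mu> = \<nu> @ [m]" "length \<nu> = ?s"
    by (cases \<mu> rule: rev_cases) auto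
  note mono = snoc.prems(3)
  let ?\<eta>' = "fst (Xi \<eta> m p)" and ?qs = "snd (Xi \<eta> m p)"
  have k: "e + int (psize p) \<le> k - int (sum_list (map psize ps))" using snoc.prems(6) by simp
  have sums: "(\<Sum>i\<in>S. \<mu> ! i) \<le> sum_list (take (card S) \<eta>) + e" if "S \<subseteq> {..<?s + 1}" for S
    using snoc.prems(4) \<eta> that by (simp add: majorizes_upto_def)
  \<comment> \<open>The singleton of the last index bounds \<open>m\<close> by the first entry of
    \<open>\<eta>\<close> plus \<open>e\<close>.\<close>
  have m1: "m \<le> \<eta> !\<^sub>1 1 + k - int (psize p)"
    using sums[of "{?s}"] \<mu> k \<eta> by (cases \<eta>) (auto simp: nth_append)
  \<comment> \<open>All indices but the last, compared with the total, bound \<open>m\<close> below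
    by the last entry of \<open>\<eta>\<close> minus \<open>e\<close>.\<close>
  have "sum_list \<eta> = sum_list \<nu> + m" using snoc.prems(4) \<mu> by (simp add: majorizes_upto_def)
  moreover have "sum_list \<eta> = sum_list (take ?s \<eta>) + \<eta> !\<^sub>1 (?s + 1)"
    using arg_cong[OF take_Suc_conv_app_nth[of ?s \<eta>], of sum_list] \<eta> by simp
  moreover have "(\<Sum>i<?s. \<mu> ! i) = sum_list \<nu>"
    using \<mu> by (simp add: sum_list_sum_nth atLeast0LessThan nth_append)
  ultimately have m2: "m \<ge> \<eta> !\<^sub>1 (?s + 1) - k + int (psize p)"
    using sums[of "{..<?s}"] k by auto
  note step = Xi_interlace[OF p \<eta> mono m1 m2]
  have len: "length ?\<eta>' = ?s" "length ?qs = ?s"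
    using length_fst_Xi[OF \<eta>] length_snd_Xi[OF \<eta>] by auto
  have inter: "interlace (shift_seq k \<eta>) (shift_seq k ?\<eta>')"
    unfolding interlace_def using step(1,2) \<eta> len by simp
  let ?P = "Phi ?\<eta>' \<nu> ps"
  have IH: "is_POP (length ps) (map (shift_seq k) (fst ?P), snd ?P) \<and>
    weight (length ps) (map (shift_seq k) (fst ?P)) = map (\<lambda>m. m + k) \<nu> \<and>
    proper_area (length ps) (map (shift_seq k) (fst ?P)) + int (overlay_size (length ps) (snd ?P))
      = int (sum_list (map psize ps))"
  proof (rule snoc.IH)
    show "majorizes_upto (e + int (psize p)) ?\<eta>' \<nu>"
      using majorizes_upto_Xi[OF _ _ \<eta> p] snoc.prems(4,5) \<mu> by simp
  qed (use len snoc.prems(2,5) k interlace_imp_non_increasing[OF inter] in auto)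
  have L: "length (map (shift_seq k) (fst ?P)) = ?s" "length (snd ?P) = length ps"
    "last (map (shift_seq k) (fst ?P)) = shift_seq k ?\<eta>'"
    using length_fst_Phi[of ?\<eta>' \<nu> ps] length_snd_Phi[of ?\<eta>' \<nu> ps] last_fst_Phi[of ?\<eta>' \<nu> ps]
    by (auto simp: last_map simp flip: length_greater_0_conv)
  have sum: "sum_list (shift_seq k \<eta>) - sum_list (shift_seq k ?\<eta>') = m + k"
  proof -
    have "\<eta> \<noteq> []" "?\<eta>' \<noteq> []" using \<eta> len by auto
    then show ?thesis
      using sum_list_fst_Xi[OF \<eta>, of m p] len \<eta> by (simp add: sum_list_shift_seq algebra_simps)
  qed
  have "is_POP ?s (map (shift_seq k) (fst ?P) @ [shift_seq k \<eta>], snd ?P @ [?qs])"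
    unfolding is_POP_snoc[OF L(1,2)] L(3) using IH \<eta> mono inter len step(3,4) by auto
  moreover have "length (last (map (shift_seq k) (fst ?P))) = ?s" using L(3) len by simp
  note area = proper_area_snoc[OF L(1) this]
  ultimately show ?case
    using IH psize_Xi[OF p \<eta> mono, of m] sum
    by (simp add: \<mu>(1) Phi_snoc[OF \<mu>(2)] L weight_snoc[OF L(1)] area overlay_size_snoc[OF L(2)])
qed

text \<open>Peel off the top row and undo the shift of the next one; the weight gives the difference
  of the unshifted row sums, and \<open>Xi_surj\<close> yields the partition.
  \<open>psize_Xi\<close> adds up the sizes.\<close>

lemma Phi_surj:
  assumes "is_POP r (L, Q)" and "length \<eta> = Suc r" and "length \<mu> = Suc r"
    and "L !\<^sub>1 Suc r = shift_seq k \<eta>" and "weight r L = map (\<lambda>m. m + k) \<mu>"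
  shows "\<exists>ps. length ps = r \<and> (\<forall>p\<in>set ps. is_partition p) \<and> shift_array k (Phi \<eta> \<mu> ps) = (L, Q) \<and>
    proper_area r L + int (overlay_size r Q) = int (sum_list (map psize ps))"
  using assms
proof (induction r arbitrary: L Q \<eta> \<mu>)
  case 0
  then have "L = [shift_seq k \<eta>]" "Q = []"
    by (auto simp: is_POP_def integral_GT_pattern_def length_Suc_conv)
  then show ?case
    by (auto simp: shift_array_eq proper_area_def overlay_size_def)
next
  case (Suc r)
  let ?s = "Suc r"
  have "length L = Suc ?s" "length Q = ?s"
    using Suc.prems(1) by (auto simp: is_POP_def integral_GT_pattern_def)
  then obtain M la P qs where L: "L = M @ [la]" "length M = Suc r" and Q: "Q = P @ [qs]" "length P = r"
    by (cases L rule: rev_cases; cases Q rule: rev_cases) auto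
  obtain \<nu> m where \<mu>: "\<mu> = \<nu> @ [m]" "length \<nu> = Suc r"
    using Suc.prems(3) by (cases \<mu> rule: rev_cases) auto
  have la: "la = shift_seq k \<eta>" using Suc.prems(4) L by (simp add: nth_append)
  define \<eta>' where "\<eta>' = shift_seq (- k) (last M)"
  have last: "last M = shift_seq k \<eta>'" by (simp add: \<eta>'_def)
  have POP: "is_POP r (M, P)" and mono: "non_increasing la" and inter: "interlace la (last M)"
    and qs: "length qs = ?s" "\<And>i. 1 \<le> i \<Longrightarrow> i \<le> ?s \<Longrightarrow> is_partition (qs !\<^sub>1 i)"
      "\<And>i. 1 \<le> i \<Longrightarrow> i \<le> ?s \<Longrightarrow>
        fits_into (qs !\<^sub>1 i) (la !\<^sub>1 i - last M !\<^sub>1 i) (last M !\<^sub>1 i - la !\<^sub>1 (i + 1))"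
    using Suc.prems(1) unfolding L(1) Q(1) is_POP_snoc[OF L(2) Q(2)] by auto
  have len: "length \<eta> = ?s + 1" "?s \<ge> 1" "length \<eta>' = ?s"
    using Suc.prems(2) inter last la by (auto simp: interlace_def)
  have w: "weight r M = map (\<lambda>m. m + k) \<nu>" "sum_list la - sum_list (last M) = m + k"
    using Suc.prems(5) unfolding L(1) weight_snoc[OF L(2)] \<mu>(1) by auto
  have "\<eta> \<noteq> []" "\<eta>' \<noteq> []" using len by auto
  then have m: "sum_list \<eta> - sum_list \<eta>' = m"
    using w(2) len by (simp add: la last sum_list_shift_seq algebra_simps)
  obtain p where p: "is_partition p" "Xi \<eta> m p = (\<eta>', qs)"
    using Xi_surj[OF len qs(1) m inter[unfolded la last] qs(2) qs(3)[unfolded la last]] by blast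
  obtain ps where ps: "length ps = r" "\<forall>p\<in>set ps. is_partition p" "shift_array k (Phi \<eta>' \<nu> ps) = (M, P)"
    "proper_area r M + int (overlay_size r P) = int (sum_list (map psize ps))"
    using Suc.IH[OF POP len(3) \<mu>(2) _ w(1)] last_nth1[OF L(2)] last by auto
  have "shift_array k (Phi \<eta> \<mu> (ps @ [p])) = (L, Q)"
    using ps(1,3) \<mu> p(2) by (simp add: Phi_snoc shift_array_eq L(1) Q(1) la)
  moreover have "length (last M) = Suc r" using last len by simp
  then have "proper_area ?s L + int (overlay_size ?s Q) = int (sum_list (map psize (ps @ [p])))"
    using ps(4) psize_Xi[OF p(1) len(1,2) mono[unfolded la], of m] p(2)
    by (simp add: L(1) Q(1) proper_area_snoc[OF L(2)] overlay_size_snoc[OF Q(2)] la last)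
  ultimately show ?case
    using ps(1,2) p(1) by (intro exI[of _ "ps @ [p]"]) auto
qed

text \<open>The increments 2k, k, ..., k, 0 are themselves non-increasing.\<close>

lemma non_increasing_shift_seq:
  assumes "non_increasing \<eta>" and "k \<ge> 0"
  shows "non_increasing (shift_seq k \<eta>)"
proof (cases "length \<eta> \<le> 1")
  case True
  then show ?thesis by (cases \<eta>) (simp_all add: shift_seq_def)
next
  case False
  then have \<eta>: "length \<eta> = (length \<eta> - 1) + 1" "length \<eta> - 1 \<ge> 1" by auto
  show ?thesis
    unfolding sorted_wrt_iff_nth_less
  proof (intro allI impI)
    fix i j assume ij: "i < j" "j < length (shift_seq k \<eta>)"
    then have "\<eta> ! j \<le> \<eta> ! i" by (intro sorted_wrt_nth_less[OF assms(1)]) auto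
    then show "shift_seq k \<eta> ! i \<ge> shift_seq k \<eta> ! j"
      using shift_seq_nth1[OF \<eta>, of "Suc i" k] shift_seq_nth1[OF \<eta>, of "Suc j" k] ij assms(2) by auto
  qed
qed

theorem theorem5p10:
  fixes r d :: nat and la \<mu> :: "int list" and k :: int
  assumes "r \<ge> 1"
    and "length la = r + 1"
    and "non_increasing la"
    and "length \<mu> = r + 1"
    and "majorizes la \<mu>"
    and "k \<ge> int d"
  shows "bij_betw (shift_array k \<circ> Phi la \<mu>)
           (colored_partitions r d) (shifted_POPs r la \<mu> k d)"
proof (rule bij_betw_imageI)
  show "inj_on (shift_array k \<circ> Phi la \<mu>) (colored_partitions r d)"
  proof (rule inj_onI)
    fix ps ps'
    assume *: "ps \<in> colored_partitions r d" "ps' \<in> colored_partitions r d"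
      "(shift_array k \<circ> Phi la \<mu>) ps = (shift_array k \<circ> Phi la \<mu>) ps'"
    then have "Phi la \<mu> ps = Phi la \<mu> ps'" using inj_shift_array[of k "Phi la \<mu> ps" "Phi la \<mu> ps'"] by simp
    then show "ps = ps'"
      using * assms(2,4) by (intro Phi_inj[of la ps \<mu> ps']) (auto simp: colored_partitions_def)
  qed
  show "(shift_array k \<circ> Phi la \<mu>) ` colored_partitions r d = shifted_POPs r la \<mu> k d"
  proof (intro subset_antisym subsetI)
    fix X assume "X \<in> (shift_array k \<circ> Phi la \<mu>) ` colored_partitions r d"
    then obtain ps where ps: "length ps = r" "\<forall>p\<in>set ps. is_partition p" "sum_list (map psize ps) = d"
      and X: "X = shift_array k (Phi la \<mu> ps)"
      by (auto simp: colored_partitions_def)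
    have "fst (Phi la \<mu> ps) !\<^sub>1 Suc r = la"
      using last_nth1[OF length_fst_Phi[of la \<mu> ps]] unfolding last_fst_Phi ps(1) .
    then have "bounding_sequence r (map (shift_seq k) (fst (Phi la \<mu> ps))) = shift_seq k la"
      using length_fst_Phi[of la \<mu> ps] ps(1) by (simp add: bounding_sequence_def)
    moreover have "non_increasing (shift_seq k la)"
      using assms(3,6) by (intro non_increasing_shift_seq) auto
    then have "is_POP r (map (shift_seq k) (fst (Phi la \<mu> ps)), snd (Phi la \<mu> ps)) \<and>
      weight r (map (shift_seq k) (fst (Phi la \<mu> ps))) = map (\<lambda>m. m + k) \<mu> \<and>
      proper_area r (map (shift_seq k) (fst (Phi la \<mu> ps))) + int (overlay_size r (snd (Phi la \<mu> ps)))
        = int d"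
      \<comment> \<open>With defect 0 at the top row the invariant reads
        \<open>d \<le> k\<close>.\<close>
      using Phi_is_POP[of la ps k 0 \<mu>] majorizes_imp_majorizes_upto[OF assms(5,3)] assms(2,6) ps
      by simp
    ultimately show "X \<in> shifted_POPs r la \<mu> k d"
      unfolding X shift_array_eq shifted_POPs_def by blast
  next
    fix X assume "X \<in> shifted_POPs r la \<mu> k d"
    then obtain L Q where X: "X = (L, Q)" "is_POP r (L, Q)" "bounding_sequence r L = shift_seq k la"
      "weight r L = map (\<lambda>m. m + k) \<mu>" "proper_area r L + int (overlay_size r Q) = int d"
      by (auto simp: shifted_POPs_def)
    then obtain ps where "length ps = r" "\<forall>p\<in>set ps. is_partition p"
      "shift_array k (Phi la \<mu> ps) = (L, Q)" "int (sum_list (map psize ps)) = int d"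
      using Phi_surj[of r L Q la \<mu> k] assms(2,4) by (auto simp: bounding_sequence_def)
    then show "X \<in> (shift_array k \<circ> Phi la \<mu>) ` colored_partitions r d"
      unfolding X(1) by (intro image_eqI[of _ _ ps]) (auto simp: colored_partitions_def)
  qed
qed

end
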